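(* Let $A$ be the path matrix of a (nonnegative weighted) planar network $D$ of order $n$ and let $\lambda\vdash n$. Then $\mathrm{Imm}_{\psi^\lambda}(A)$ is equal to each of $$\sum_{\pi\in\mathcal P_e(D)}\mathrm{wgt}(\pi)\cdot\#\{\text{cyclically row-semistrict }P(\pi)\text{-tableaux of shape }\lambda\},$$ $$\sum_{\pi\in\mathcal P_e(D)}\mathrm{wgt}(\pi)\cdot\#\{P(\pi)\text{-record-free row-semistrict }P(\pi)\text{-tableaux of shape }\lambda\},$$ $$\sum_{\pi\in\mathcal P(D)}\mathrm{wgt}(\pi)\cdot\#\{\text{cylindrical }\pi\text{-tableaux of shape }\lambda\}.$$
   Context: A (nonnegative weighted) planar network of order $n$ is a directed, planar, acyclic digraph $D=(V,E)$ which can be embedded in a disc so that $2n$ distinguished vertices, labeled clockwise as $s_1,\dots,s_n,t_n,\dots,t_1$, lie on the boundary of the disc, with a nonnegative real weight assigned to each edge; the sources $s_i$ have indegree $0$ and the sinks $t_i$ have outdegree $0$. The weight of a source-to-sink path is the product of the weights of its edges. The path matrix $A=(a_{i,j})_{i,j\in[n]}$ of $D$ has $a_{i,j}$ equal to the sum of weights of all paths from $s_i$ to $t_j$. A path family $\pi=(\pi_1,\dots,\pi_n)$ has type $w=w_1\cdots w_n\in\mathfrak S_n$ if $\pi_i$ is a path from $s_i$ to $t_{w_i}$ for all $i$; $\mathrm{wgt}(\pi)=\mathrm{wgt}(\pi_1)\cdots\mathrm{wgt}(\pi_n)$. $\mathcal P(D)$ is the set of path families in $D$ of all types $w\in\mathfrak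 S_n$, and $\mathcal P_e(D)$ the subset of those whose type is the identity. For $\pi\in\mathcal P_e(D)$, $P(\pi)$ is the poset on $\{\pi_1,\dots,\pi_n\}$ with $\pi_i<\pi_j$ if and only if $i<j$ and $\pi_i$, $\pi_j$ do not intersect (share no vertex). For a class function $\theta$ on $\mathfrak S_n$, $\mathrm{Imm}_\theta(A)=\sum_{w\in\mathfrak S_n}\theta(w)a_{1,w_1}\cdots a_{n,w_n}$. $\psi^\lambda$ is the class function with $\psi^\lambda(w)=z_\lambda$ if $w$ has cycle type $\lambda$ and $0$ otherwise, where $z_\lambda=\lambda_1\cdots\lambda_\ell\,\alpha_1!\cdots\alpha_n!$ and $\alpha_i$ is the number of parts of $\lambda$ equal to $i$. For a poset $P$, a $P$-tableau of shape $\lambda\vdash|P|$ is a filling of a Young diagram of shape $\lambda$ (with $\lambda_i$ boxes in row $i$) with the elements of $P$, each used once; $U_{i,j}$ is the $j$th entry of row $i$. It is row-semistrict if $U_{i,j}\not>_PU_{i,j+1}$ always; cyclically row-semistrict if row-semistrict and $U_{i,\lambda_i}\not>_PU_{i,1}$ for all $i$; $P$-record-free if there is no position $(i,j)$ with $j\ne1$ such that all of $U_{i,1},\dots,U_{i,j-1}$ are $<_PU_{i,j}$. For $\pi\in\mathcal P(D)$, a $\pi$-tableau of shape $\lambda$ is a filling of a Young diagram of shape $\lambda$ with $\pi_1,\dots,\pi_n$, each used once. It is cylindrical if in each row $U_i=U_{i,1}\cdots U_{i,\lambda_i}$ the sequence of sink indices of $U_{i,1},\dots,U_{i,\lambda_i}$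 equals the sequence of source indices of $U_{i,2},\dots,U_{i,\lambda_i},U_{i,1}$ (each path begins at the index where the cyclically preceding path in its row terminates). *)

theory Defs
  imports
    "HOL-Analysis.Analysis"
    "HOL-Combinatorics.Orbits"
    "HOL-Combinatorics.Permutations"
    "HOL-Library.Multiset"
    "HOL-Library.FuncSet"
    "Graph_Theory.Digraph"
    "Graph_Theory.Arc_Walk"
begin

section \<open>Planar networks\<close>

text \<open>Angles decrease along a clockwise traversal. The two conditions on the angles make the
  listed points pairwise distinct and confine the listing to a single turn of the circle.\<close>

definition clockwise_on_circle :: "complex list \<Rightarrow> bool" where
  "clockwise_on_circle zs \<longleftrightarrow>
     (\<exists>\<theta>s :: real list. zs = map cis \<theta>s \<and> sorted_wrt (>) \<theta>s \<and>
        (\<forall>a\<in>set \<theta>s. \<forall>b\<in>set \<theta>s. a - b < 2 * pi))"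

text \<open>Drawings in the closed unit disc. Two edges may only meet at a common endpoint, since the
  curve of an edge contains no vertex other than its two ends.\<close>

definition disc_embedding ::
    "('a, 'b) pre_digraph \<Rightarrow> ('a \<Rightarrow> complex) \<Rightarrow> ('b \<Rightarrow> real \<Rightarrow> complex) \<Rightarrow> bool" where
  "disc_embedding D pos crv \<longleftrightarrow>
     inj_on pos (verts D) \<and> pos ` verts D \<subseteq> cball 0 1 \<and>
     (\<forall>e\<in>arcs D. arc (crv e) \<and> path_image (crv e) \<subseteq> cball 0 1 \<and>
        pathstart (crv e) = pos (tail D e) \<and> pathfinish (crv e) = pos (head D e) \<and>
        path_image (crv e) \<inter> pos ` verts D \<subseteq> {pos (tail D e), pos (head D e)}) \<and>
     (\<forall>e\<in>arcs D. \<forall>e'\<in>arcs D. e \<noteq> e' \<longrightarrow>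
        path_image (crv e) \<inter> path_image (crv e') \<subseteq> pos ` verts D)"

text \<open>Sources and sinks are indexed by \<^term>\<open>{1..n::nat}\<close>; parallel edges are permitted.
  That the \<open>2n\<close> distinguished vertices are distinct is part of \<^const>\<open>clockwise_on_circle\<close>.\<close>

locale planar_network = fin_digraph D for D :: "('a, 'b) pre_digraph" +
  fixes n :: nat and wt :: "'b \<Rightarrow> real" and s t :: "nat \<Rightarrow> 'a"
  assumes acyclic: "acyclic (arcs_ends D)"
    and weight_nonneg: "\<And>e. e \<in> arcs D \<Longrightarrow> 0 \<le> wt e"
    and source_in_verts: "\<And>i. i \<in> {1..n} \<Longrightarrow> s i \<in> verts D"
    and sink_in_verts: "\<And>i. i \<in> {1..n} \<Longrightarrow> t i \<in> verts D"
    and source_in_degree: "\<And>i. i \<in> {1..n} \<Longrightarrow> in_degree D (s i) = 0"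
    and sink_out_degree: "\<And>i. i \<in> {1..n} \<Longrightarrow> out_degree D (t i) = 0"
    and planar: "\<exists>pos crv. disc_embedding D pos crv \<and>
      clockwise_on_circle (map pos (map s [1..<Suc n] @ rev (map t [1..<Suc n])))"

text \<open>A path is the list of its arcs. No source is a sink, so source-to-sink paths are nonempty
  and determine their endpoints.\<close>

definition paths_between :: "('a, 'b) pre_digraph \<Rightarrow> 'a \<Rightarrow> 'a \<Rightarrow> 'b list set" where
  "paths_between D u v = {p. pre_digraph.apath D u p v}"

definition path_weight :: "('b \<Rightarrow> real) \<Rightarrow> 'b list \<Rightarrow> real" where
  "path_weight wt p = prod_list (map wt p)"

definition path_matrix ::
    "('a, 'b) pre_digraph \<Rightarrow> ('b \<Rightarrow> real) \<Rightarrow> (nat \<Rightarrow> 'a) \<Rightarrow> (nat \<Rightarrow> 'a) \<Rightarrow> nat \<Rightarrow> nat \<Rightarrow> real" where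
  "path_matrix D wt s t i j = (\<Sum>p\<in>paths_between D (s i) (t j). path_weight wt p)"


section \<open>Path families\<close>

definition family_has_type ::
    "('a, 'b) pre_digraph \<Rightarrow> nat \<Rightarrow> (nat \<Rightarrow> 'a) \<Rightarrow> (nat \<Rightarrow> 'a) \<Rightarrow> (nat \<Rightarrow> 'b list) \<Rightarrow> (nat \<Rightarrow> nat) \<Rightarrow> bool"
  where
  "family_has_type D n s t \<pi> w \<longleftrightarrow> (\<forall>i\<in>{1..n}. \<pi> i \<in> paths_between D (s i) (t (w i)))"

definition path_families ::
    "('a, 'b) pre_digraph \<Rightarrow> nat \<Rightarrow> (nat \<Rightarrow> 'a) \<Rightarrow> (nat \<Rightarrow> 'a) \<Rightarrow> (nat \<Rightarrow> 'b list) set" where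
  "path_families D n s t =
     {\<pi> \<in> extensional {1..n}. \<exists>w. w permutes {1..n} \<and> family_has_type D n s t \<pi> w}"

definition path_families_id ::
    "('a, 'b) pre_digraph \<Rightarrow> nat \<Rightarrow> (nat \<Rightarrow> 'a) \<Rightarrow> (nat \<Rightarrow> 'a) \<Rightarrow> (nat \<Rightarrow> 'b list) set" where
  "path_families_id D n s t = {\<pi> \<in> path_families D n s t. family_has_type D n s t \<pi> id}"

definition family_weight :: "nat \<Rightarrow> ('b \<Rightarrow> real) \<Rightarrow> (nat \<Rightarrow> 'b list) \<Rightarrow> real" where
  "family_weight n wt \<pi> = (\<Prod>i=1..n. path_weight wt (\<pi> i))"

text \<open>The poset \<open>P(\<pi>)\<close> has carrier \<open>family_paths n \<pi>\<close> and strict order \<open>family_less D n s \<pi>\<close>.\<close>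

definition family_paths :: "nat \<Rightarrow> (nat \<Rightarrow> 'b list) \<Rightarrow> 'b list set" where
  "family_paths n \<pi> = \<pi> ` {1..n}"

definition family_less ::
    "('a, 'b) pre_digraph \<Rightarrow> nat \<Rightarrow> (nat \<Rightarrow> 'a) \<Rightarrow> (nat \<Rightarrow> 'b list) \<Rightarrow> 'b list \<Rightarrow> 'b list \<Rightarrow> bool" where
  "family_less D n s \<pi> p q \<longleftrightarrow>
     (\<exists>i\<in>{1..n}. \<exists>j\<in>{1..n}. p = \<pi> i \<and> q = \<pi> j \<and> i < j \<and>
        set (pre_digraph.awalk_verts D (s i) (\<pi> i)) \<inter>
        set (pre_digraph.awalk_verts D (s j) (\<pi> j)) = {})"


section \<open>Immanants\<close>

definition immanant :: "nat \<Rightarrow> ((nat \<Rightarrow> nat) \<Rightarrow> real) \<Rightarrow> (nat \<Rightarrow> nat \<Rightarrow> real) \<Rightarrow> real" where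
  "immanant n \<theta> A = (\<Sum>w | w permutes {1..n}. \<theta> w * (\<Prod>i=1..n. A i (w i)))"

definition is_partition :: "nat list \<Rightarrow> nat \<Rightarrow> bool" (infix \<open>\<turnstile>\<close> 50) where
  "lam \<turnstile> n \<longleftrightarrow> sorted_wrt (\<ge>) lam \<and> 0 \<notin> set lam \<and> sum_list lam = n"

definition cycle_type :: "nat \<Rightarrow> (nat \<Rightarrow> nat) \<Rightarrow> nat multiset" where
  "cycle_type n w = image_mset card (mset_set (orbit w ` {1..n}))"

definition z_partition :: "nat list \<Rightarrow> nat" where
  "z_partition lam = prod_list lam * (\<Prod>i=1..sum_list lam. fact (count_list lam i))"

definition psi :: "nat list \<Rightarrow> (nat \<Rightarrow> nat) \<Rightarrow> real" where
  "psi lam w = (if cycle_type (sum_list lam) w = mset lam then real (z_partition lam) else 0)"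


section \<open>Tableaux\<close>

text \<open>A tableau is the list of its rows. The poset is given by its carrier \<open>X\<close> and its strict order
  \<open>lt\<close>.\<close>

definition tableaux :: "'c set \<Rightarrow> nat list \<Rightarrow> 'c list list set" where
  "tableaux X lam = {U. map length U = lam \<and> distinct (concat U) \<and> set (concat U) = X}"

definition row_semistrict :: "('c \<Rightarrow> 'c \<Rightarrow> bool) \<Rightarrow> 'c list list \<Rightarrow> bool" where
  "row_semistrict lt U \<longleftrightarrow>
     (\<forall>r\<in>set U. \<forall>j. Suc j < length r \<longrightarrow> \<not> lt (r ! Suc j) (r ! j))"

definition cyclically_row_semistrict :: "('c \<Rightarrow> 'c \<Rightarrow> bool) \<Rightarrow> 'c list list \<Rightarrow> bool" where
  "cyclically_row_semistrict lt U \<longleftrightarrow>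
     row_semistrict lt U \<and> (\<forall>r\<in>set U. \<not> lt (hd r) (last r))"

definition record_free :: "('c \<Rightarrow> 'c \<Rightarrow> bool) \<Rightarrow> 'c list list \<Rightarrow> bool" where
  "record_free lt U \<longleftrightarrow>
     \<not> (\<exists>r\<in>set U. \<exists>j. 0 < j \<and> j < length r \<and> (\<forall>k<j. lt (r ! k) (r ! j)))"

definition source_index :: "('a, 'b) pre_digraph \<Rightarrow> nat \<Rightarrow> (nat \<Rightarrow> 'a) \<Rightarrow> 'b list \<Rightarrow> nat" where
  "source_index D n s p = (THE i. i \<in> {1..n} \<and> (\<exists>v. p \<in> paths_between D (s i) v))"

definition sink_index :: "('a, 'b) pre_digraph \<Rightarrow> nat \<Rightarrow> (nat \<Rightarrow> 'a) \<Rightarrow> 'b list \<Rightarrow> nat" where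
  "sink_index D n t p = (THE j. j \<in> {1..n} \<and> (\<exists>u. p \<in> paths_between D u (t j)))"

definition cylindrical ::
    "('a, 'b) pre_digraph \<Rightarrow> nat \<Rightarrow> (nat \<Rightarrow> 'a) \<Rightarrow> (nat \<Rightarrow> 'a) \<Rightarrow> 'b list list list \<Rightarrow> bool" where
  "cylindrical D n s t U \<longleftrightarrow>
     (\<forall>r\<in>set U. map (sink_index D n t) r = map (source_index D n s) (rotate1 r))"

end

theory Submission
  imports
    Defs
    "HOL-Combinatorics.Cycles"
    "HOL-Combinatorics.Multiset_Permutations"
begin

text \<open>The coefficients of \<open>psi lam\<close> count the ways of writing a permutation as a tableau whose rows are its
  cycles, so the immanant is the sum over tableaux on \<open>{1..n}\<close> of the products of the cyclic words
  \<open>a(r1,r2) a(r2,r3) ... a(rl,r1)\<close> of the rows. This is already the cylindrical formula. The other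
  two formulas also factor over rows, so that it suffices to compare, for every set \<open>B\<close> of indices,
  the sums over all orderings of \<open>B\<close> as a single row.

  The sums \<open>p(B)\<close> of the cyclic words satisfy the Newton identity
  \<open>|B| e(B) = sum over nonempty C of (-1)^(|C|-1) p(C) e(B - C)\<close>, where \<open>e(B)\<close> is the principal minor of
  the path matrix, and they are determined by it. By the Lindstroem-Gessel-Viennot lemma, \<open>e(B)\<close> is
  the generating function of the families on \<open>B\<close> that are chains of \<open>P(\<pi>)\<close>. Hence it suffices
  that for every single poset the numbers of cyclically semistrict orderings, and of record-free
  semistrict orderings, satisfy the same identity with \<open>e(B) = 1\<close> for chains and \<open>e(B) = 0\<close>
  otherwise. The former is the Newton identity for the matrix whose \<open>(x,y)\<close> entry tells whether
  \<open>x > y\<close> fails, the latter a sign-reversing involution. Planarity enters only through the fact that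
  paths with interlaced end points meet.\<close>

text \<open>The three sums cannot be matched family by family: families of all types enter the
  cylindrical sum, only those of identity type enter the other two. The minors \<open>e(B)\<close>
  are where types are exchanged for posets, since such a minor is a signed sum over all types and,
  after cancellation, an unsigned sum over the chains among the identity families. The identity
  known for each single poset can then be summed against the weights, because the weight of a family
  on a disjoint union of index sets is a product and because a condition on a row looks only at the
  paths in that row.

  Planarity acts twice through the crossing property: it forces a family of nonidentity type to have
  an intersection, and it makes \<open>P(\<pi>)\<close> transitive, which both identities for posets
  use. Posets are handled on the indices \<open>{1..n}\<close>, where the natural order is a linear
  extension; the passage to tableaux filled with paths is a relabelling made at the very
  end.\<close>

section \<open>Crossing chords of a disc\<close>

text \<open>A Moebius automorphism of the disc. It fixes \<open>1\<close> and \<open>- 1\<close>, and for \<open>a\<close> close to \<open>1\<close> it moves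
  any given compact arc of the circle avoiding \<open>- 1\<close> into the right half plane, where
  \<open>flatten_disc\<close> maps the circle to the bottom side of a box. This reduces crossing chords of
  the disc to the theorem \<open>fashoda_interlace\<close> about boxes.\<close>

definition disc_shift :: "real \<Rightarrow> complex \<Rightarrow> complex" where
  "disc_shift a z = (z + of_real a) / (1 + of_real a * z)"

definition flatten_disc :: "complex \<Rightarrow> real^2" where
  "flatten_disc z = vector [- Im z, sqrt (1 - (Im z)\<^sup>2) - Re z]"

text \<open>The pole \<open>- 1 / a\<close> lies outside the closed disc.\<close>

lemma disc_shift_denom_nonzero:
  assumes "cmod z \<le> 1" "0 < a" "a < 1"
  shows "1 + of_real a * z \<noteq> (0::complex)"
proof
  assume "1 + of_real a * z = 0"
  then have "of_real a * z = -1" by (simp add: add_eq_0_iff)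
  then have "cmod (of_real a * z) = 1" by simp
  moreover have "cmod (of_real a * z) < 1"
    using assms mult_le_less_imp_less[of a 1] by (simp add: norm_mult) (smt (verit) mult_left_le)
  ultimately show False by simp
qed

lemma norm_disc_shift:
  assumes "0 < a" "a < 1" "cmod z \<le> 1"
  shows "cmod (disc_shift a z) \<le> 1" and "cmod z = 1 \<Longrightarrow> cmod (disc_shift a z) = 1"
proof -
  \<comment> \<open>This identity gives both claims: its right-hand side is nonnegative on the disc
    and zero on the circle.\<close>
  have eq: "(cmod (1 + of_real a * z))\<^sup>2 - (cmod (z + of_real a))\<^sup>2 = (1 - a\<^sup>2) * (1 - (cmod z)\<^sup>2)"
    unfolding cmod_power2 by (simp add: power2_eq_square algebra_simps)
  have pos: "cmod (1 + of_real a * z) > 0" using disc_shift_denom_nonzero assms by simp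
  have "(1 - a\<^sup>2) * (1 - (cmod z)\<^sup>2) \<ge> 0"
    using assms by (intro mult_nonneg_nonneg) (auto simp: power_le_one_iff abs_square_le_1)
  with eq have "(cmod (z + of_real a))\<^sup>2 \<le> (cmod (1 + of_real a * z))\<^sup>2" by linarith
  then have "cmod (z + of_real a) \<le> cmod (1 + of_real a * z)" by (rule power2_le_imp_le) simp
  then show "cmod (disc_shift a z) \<le> 1" using pos by (simp add: disc_shift_def norm_divide)
  assume "cmod z = 1"
  with eq have "(cmod (z + of_real a))\<^sup>2 = (cmod (1 + of_real a * z))\<^sup>2" by simp
  then have "cmod (z + of_real a) = cmod (1 + of_real a * z)" by simp
  then show "cmod (disc_shift a z) = 1" using pos by (simp add: disc_shift_def norm_divide)
qed

lemma disc_shift_inj: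
  assumes "0 < a" "a < 1" "cmod z \<le> 1" "cmod w \<le> 1" "disc_shift a z = disc_shift a w"
  shows "z = w"
proof -
  have "(z + of_real a) * (1 + of_real a * w) = (w + of_real a) * (1 + of_real a * z)"
    using assms(5) disc_shift_denom_nonzero[OF assms(3,1,2)] disc_shift_denom_nonzero[OF assms(4,1,2)]
    by (simp add: disc_shift_def frac_eq_eq)
  then have "(1 - (of_real a)\<^sup>2) * (z - w) = 0" by (simp add: algebra_simps power2_eq_square)
  moreover have "1 - (of_real a)\<^sup>2 \<noteq> (0::complex)"
    using assms(1,2) by (metis eq_iff_diff_eq_0 of_real_1 of_real_eq_iff of_real_power power2_eq_1_iff
      less_irrefl less_trans minus_less_iff neg_0_less_iff_less zero_less_one)
  ultimately show ?thesis by simp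
qed

text \<open>The common denominator is the squared modulus of \<open>1 + a * cis \<theta>\<close>.
  The imaginary part is kept as a constant times a quotient so that its monotonicity is that of the
  quotient; the numerator of the real part decides when the image lies in the right half
  plane.\<close>

lemma disc_shift_cis:
  assumes "0 < a" "a < 1"
  shows "Im (disc_shift a (cis \<theta>)) = (1 - a\<^sup>2) * (sin \<theta> / (1 + a\<^sup>2 + 2 * a * cos \<theta>))" (is ?I)
    and "Re (disc_shift a (cis \<theta>)) = ((1 + a\<^sup>2) * cos \<theta> + 2 * a) / (1 + a\<^sup>2 + 2 * a * cos \<theta>)" (is ?R)
    and "1 + a\<^sup>2 + 2 * a * cos \<theta> > 0" (is ?P)
proof -
  have N: "(cmod (1 + of_real a * cis \<theta>))\<^sup>2 = 1 + a\<^sup>2 + 2 * a * cos \<theta>"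
    using sin_cos_squared_add[of \<theta>] unfolding cmod_power2
    by (simp add: power2_eq_square) algebra
  have "cmod (1 + of_real a * cis \<theta>) > 0"
    using disc_shift_denom_nonzero[of "cis \<theta>" a] assms by simp
  then show ?P by (simp flip: N)
  have N': "(Re (1 + of_real a * cis \<theta>))\<^sup>2 + (Im (1 + of_real a * cis \<theta>))\<^sup>2 = 1 + a\<^sup>2 + 2 * a * cos \<theta>"
    using N by (simp add: cmod_power2)
  have "Im (cis \<theta> + of_real a) * Re (1 + of_real a * cis \<theta>) - Re (cis \<theta> + of_real a) * Im (1 + of_real a * cis \<theta>)
      = (1 - a\<^sup>2) * sin \<theta>"
    by (simp add: power2_eq_square algebra_simps)
  then show ?I unfolding disc_shift_def Im_divide N' by simp
  have "Re (cis \<theta> + of_real a) * Re (1 + of_real a * cis \<theta>) + Im (cis \<theta> + of_real a) * Im (1 + of_real a * cis \<theta>)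
      = (1 + a\<^sup>2) * cos \<theta> + 2 * a"
    using sin_cos_squared_add[of \<theta>] by (simp add: power2_eq_square) algebra
  then show ?R unfolding disc_shift_def Re_divide N' by simp
qed

lemma flatten_disc_inj:
  assumes "flatten_disc z = flatten_disc w"
  shows "z = w"
proof -
  have "flatten_disc z $ 1 = flatten_disc w $ 1" "flatten_disc z $ 2 = flatten_disc w $ 2"
    using assms by simp_all
  then show ?thesis by (auto simp: flatten_disc_def complex_eq_iff)
qed

text \<open>The second coordinate is the horizontal distance from the point to the right half of the
  unit circle, hence between \<open>0\<close> and \<open>2\<close> on the disc.\<close>

lemma flatten_disc_in_box:
  assumes "cmod z \<le> 1"
  shows "flatten_disc z \<in> cbox (vector [-1, 0]) (vector [1, 2])"
proof -
  have 1: "(Re z)\<^sup>2 + (Im z)\<^sup>2 \<le> 1"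
    using assms by (metis cmod_power2 norm_ge_zero power_le_one)
  have 2: "\<bar>Im z\<bar> \<le> 1" "\<bar>Re z\<bar> \<le> 1"
    using assms abs_Im_le_cmod[of z] abs_Re_le_cmod[of z] by linarith+
  have 3: "Re z \<le> sqrt (1 - (Im z)\<^sup>2)" using 1 by (intro real_le_rsqrt) simp
  have 4: "sqrt (1 - (Im z)\<^sup>2) \<le> 1" by simp
  have 5: "sqrt (1 - (Im z)\<^sup>2) - Re z \<le> 2" using 2 4 by linarith
  show ?thesis using 2 3 5
    by (auto simp: flatten_disc_def mem_box_cart forall_2)
qed

lemma continuous_flatten_disc: "continuous_on UNIV flatten_disc"
proof -
  have "continuous_on UNIV (\<lambda>z. flatten_disc z $ i)" for i
    using exhaust_2[of i] unfolding flatten_disc_def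
    by (elim disjE) (simp_all, (intro continuous_intros)+)
  then have "continuous_on UNIV (\<lambda>z. \<chi> i. flatten_disc z $ i)" by (rule continuous_on_vec_lambda)
  then show ?thesis by simp
qed

text \<open>The numerator of the derivative is the same expression as the numerator of the real part
  in \<open>disc_shift_cis\<close>. So one positivity condition yields both the order of the image
  points and their position in the right half plane.\<close>

lemma sin_over_cos_increasing:
  fixes a :: real
  assumes "0 < a" "a < 1" "\<theta> < \<phi>"
    and "\<And>x. \<theta> \<le> x \<Longrightarrow> x \<le> \<phi> \<Longrightarrow> (1 + a\<^sup>2) * cos x + 2 * a > 0"
  shows "sin \<theta> / (1 + a\<^sup>2 + 2 * a * cos \<theta>) < sin \<phi> / (1 + a\<^sup>2 + 2 * a * cos \<phi>)"
proof (rule DERIV_pos_imp_increasing[OF assms(3)])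
  fix x assume x: "\<theta> \<le> x" "x \<le> \<phi>"
  let ?D = "1 + a\<^sup>2 + 2 * a * cos x"
  have D: "?D > 0" by (rule disc_shift_cis(3)[OF assms(1,2)])
  have "cos x * ?D - sin x * (- (2 * a * sin x)) = (1 + a\<^sup>2) * cos x + 2 * a"
    using sin_cos_squared_add[of x] by (simp add: power2_eq_square) algebra
  moreover have "((\<lambda>x. sin x / (1 + a\<^sup>2 + 2 * a * cos x)) has_real_derivative
      (cos x * ?D - sin x * (- (2 * a * sin x))) / (?D * ?D)) (at x)"
    using D by (auto intro!: derivative_eq_intros)
  ultimately show "\<exists>y. ((\<lambda>x. sin x / (1 + a\<^sup>2 + 2 * a * cos x)) has_real_derivative y) (at x) \<and> y > 0"
    using assms(4)[OF x] D by (intro exI conjI) (assumption, simp)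
qed

lemma disc_chords_meet:
  fixes f g :: "real \<Rightarrow> complex"
  assumes path: "path f" "path g"
    and disc: "path_image f \<subseteq> cball 0 1" "path_image g \<subseteq> cball 0 1"
    and ends: "pathstart f = cis \<alpha>" "pathstart g = cis \<beta>" "pathfinish f = cis \<gamma>" "pathfinish g = cis \<delta>"
    and angles: "\<alpha> > \<beta>" "\<beta> > \<gamma>" "\<gamma> > \<delta>" "\<alpha> - \<delta> < 2 * pi"
  shows "path_image f \<inter> path_image g \<noteq> {}"
proof -
  \<comment> \<open>The rotation by \<open>- \<mu>\<close> centres the arc carrying the four end
    points at angle \<open>0\<close>; its half-width \<open>m\<close> is below \<open>pi\<close>
    because the end points span less than a full turn.\<close>
  define \<mu> where "\<mu> = (\<alpha> + \<delta>) / 2"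
  define m where "m = (\<alpha> - \<delta>) / 2"
  \<comment> \<open>The midpoint of \<open>- cos m\<close> and \<open>1\<close>. What matters is
    that \<open>a\<close> lies in between and is positive: then \<open>cos x > - a\<close> on the
    arc, and where \<open>cos x\<close> is negative, \<open>1 + a^2 \<le> 2\<close> gives the
    positivity required below.\<close>
  define a where "a = (1 - cos m) / 2"
  have m: "0 < m" "m < pi" using angles by (auto simp: m_def)
  have "cos m < 1" "cos m > -1"
    using m cos_monotone_0_pi[of 0 m] cos_monotone_0_pi[of m pi] by auto
  then have a: "0 < a" "a < 1" "a > - cos m" by (auto simp: a_def)
  have pos: "(1 + a\<^sup>2) * cos x + 2 * a > 0" if "\<bar>x\<bar> \<le> m" for x
  proof (cases "cos x \<ge> 0")
    case True
    then show ?thesis using a by (simp add: add_nonneg_pos)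
  next
    case False
    have "cos m \<le> cos \<bar>x\<bar>" using m that by (intro cos_monotone_0_pi_le) auto
    then have "cos x > - a" using a by simp
    moreover have "a\<^sup>2 \<le> 1" using a by (simp add: power_le_one)
    then have "(1 + a\<^sup>2) * (- cos x) \<le> 2 * (- cos x)" using False by (intro mult_right_mono) auto
    ultimately show ?thesis by simp
  qed
  define H where "H = (\<lambda>z. flatten_disc (disc_shift a (z * cis (- \<mu>))))"
  have rot: "cis \<theta> * cis (- \<mu>) = cis (\<theta> - \<mu>)" for \<theta> by (simp add: cis_mult)
  have rot1: "cmod (z * cis (- \<mu>)) = cmod z" for z by (simp add: norm_mult)
  have H_inj: "z = w" if "H z = H w" "cmod z \<le> 1" "cmod w \<le> 1" for z w
    using disc_shift_inj[OF a(1,2), of "z * cis (- \<mu>)" "w * cis (- \<mu>)"]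
      flatten_disc_inj[of "disc_shift a (z * cis (- \<mu>))" "disc_shift a (w * cis (- \<mu>))"] that
    by (simp add: H_def rot1)
  have H_cont: "continuous_on (cball 0 1) H"
    unfolding H_def
  proof (rule continuous_on_compose2[OF continuous_flatten_disc])
    show "continuous_on (cball 0 1) (\<lambda>z. disc_shift a (z * cis (- \<mu>)))"
      unfolding disc_shift_def
      using disc_shift_denom_nonzero[OF _ a(1,2)] rot1 by (auto intro!: continuous_intros)
  qed simp
  have H_box: "H z \<in> cbox (vector [-1, 0]) (vector [1, 2])" if "cmod z \<le> 1" for z
    unfolding H_def using that by (intro flatten_disc_in_box norm_disc_shift(1) a) (simp add: rot1)
  have H_bottom: "H (cis \<theta>) $ 2 = 0" if "\<bar>\<theta> - \<mu>\<bar> \<le> m" for \<theta>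
  proof -
    let ?w = "disc_shift a (cis (\<theta> - \<mu>))"
    have "cmod ?w = 1" using norm_disc_shift[OF a(1,2), of "cis (\<theta> - \<mu>)"] by simp
    then have "(Re ?w)\<^sup>2 + (Im ?w)\<^sup>2 = 1" by (simp flip: cmod_power2)
    moreover have "Re ?w > 0"
      using pos[OF that] disc_shift_cis[OF a(1,2)] by simp
    moreover have "sqrt ((Re ?w)\<^sup>2) = \<bar>Re ?w\<bar>" by simp
    ultimately show ?thesis unfolding H_def rot flatten_disc_def by (simp add: algebra_simps flip: eq_diff_eq)
  qed
  \<comment> \<open>Angles decrease clockwise and the flattening negates the imaginary part, so
    clockwise order becomes order from left to right.\<close>
  have H_mono: "H (cis \<phi>) $ 1 < H (cis \<theta>) $ 1" if "\<theta> < \<phi>" "\<bar>\<theta> - \<mu>\<bar> \<le> m" "\<bar>\<phi> - \<mu>\<bar> \<le> m" for \<theta> \<phi>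
  proof -
    have "sin (\<theta> - \<mu>) / (1 + a\<^sup>2 + 2 * a * cos (\<theta> - \<mu>)) < sin (\<phi> - \<mu>) / (1 + a\<^sup>2 + 2 * a * cos (\<phi> - \<mu>))"
      using that by (intro sin_over_cos_increasing a pos) auto
    moreover have "1 - a\<^sup>2 > 0" using a by (simp add: power_strict_decreasing abs_square_less_1)
    ultimately show ?thesis unfolding H_def rot flatten_disc_def
      by (simp add: disc_shift_cis[OF a(1,2)] mult_strict_left_mono del: times_divide_eq_right)
  qed
  have close: "\<bar>\<alpha> - \<mu>\<bar> \<le> m" "\<bar>\<beta> - \<mu>\<bar> \<le> m" "\<bar>\<gamma> - \<mu>\<bar> \<le> m" "\<bar>\<delta> - \<mu>\<bar> \<le> m"
    using angles unfolding \<mu>_def m_def abs_le_iff by (auto simp: field_simps)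
  have "path (H \<circ> f)" "path (H \<circ> g)"
    using path disc H_cont by (auto intro!: path_continuous_image continuous_on_subset[OF H_cont])
  moreover have "path_image (H \<circ> f) \<subseteq> cbox (vector [-1, 0]) (vector [1, 2])"
     "path_image (H \<circ> g) \<subseteq> cbox (vector [-1, 0]) (vector [1, 2])"
    using disc H_box by (auto simp: path_image_compose image_subset_iff subset_iff)
  ultimately obtain z where "z \<in> path_image (H \<circ> f)" "z \<in> path_image (H \<circ> g)"
    by (rule fashoda_interlace)
      (use ends angles close in \<open>auto simp: pathstart_compose pathfinish_compose H_bottom H_mono\<close>)
  then obtain u v where uv: "u \<in> path_image f" "v \<in> path_image g" "H u = H v"
    by (auto simp: path_image_compose)
  then have "u = v" using disc by (intro H_inj) (auto simp: subset_iff)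
  then show ?thesis using uv by auto
qed

section \<open>Cycles and determinants\<close>

definition cyc_prod :: "('a \<Rightarrow> 'a \<Rightarrow> 'b::comm_monoid_mult) \<Rightarrow> 'a list \<Rightarrow> 'b" where
  "cyc_prod a r = prod_list (map2 a r (rotate1 r))"

text \<open>A principal minor over an arbitrary index set, summed over the permutations of that set
  itself, so that splitting off a cycle on \<open>C\<close> leaves literally
  \<open>det_on (X - C)\<close>.\<close>

definition det_on :: "'a set \<Rightarrow> ('a \<Rightarrow> 'a \<Rightarrow> 'b::comm_ring_1) \<Rightarrow> 'b" where
  "det_on X a = (\<Sum>w | w permutes X. of_int (sign w) * (\<Prod>x\<in>X. a x (w x)))"

section \<open>Cycles of a permutation written as lists\<close>

text \<open>The equation \<open>map w r = rotate1 r\<close> is the encoding, used throughout, of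
  \<open>r\<close> being a cycle of \<open>w\<close>: every entry is sent to its cyclic
  successor.\<close>

lemma cyclic_list_nth:
  assumes "map w r = rotate1 r" "i < length r"
  shows "r ! i = (w ^^ i) (hd r)"
  using assms(2)
proof (induction i)
  case 0
  then show ?case by (simp add: hd_conv_nth)
next
  case (Suc i)
  have "w (r ! i) = rotate1 r ! i" using Suc.prems by (simp flip: assms(1))
  also have "\<dots> = r ! Suc i" using Suc.prems by (simp add: nth_rotate1)
  finally show ?case using Suc by simp
qed

lemma set_cyclic_list:
  assumes "map w r = rotate1 r" "r \<noteq> []"
  shows "set r = orbit w (hd r)"
proof
  have closed: "w x \<in> set r" if "x \<in> set r" for x
    using that by (metis assms(1) image_eqI set_map set_rotate1)
  show "orbit w (hd r) \<subseteq> set r"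
  proof
    fix y assume "y \<in> orbit w (hd r)"
    then show "y \<in> set r" by induction (use closed assms in auto)
  qed
  \<comment> \<open>An \<open>orbit\<close> starts with the image of its base point, so the return
    to \<open>hd r\<close> has to be established before the iterates can be placed in it.\<close>
  have "(w ^^ length r) (hd r) = hd r"
  proof -
    obtain k where k: "length r = Suc k" using assms(2) by (cases r) auto
    have "(w ^^ length r) (hd r) = w (r ! k)" using cyclic_list_nth[OF assms(1), of k] k by simp
    also have "\<dots> = rotate1 r ! k" using k by (simp flip: assms(1))
    also have "\<dots> = hd r" using k assms(2) by (simp add: nth_rotate1 hd_conv_nth)
    finally show ?thesis .
  qed
  then have hd: "hd r \<in> orbit w (hd r)"
    using assms(2) by (metis (mono_tags, lifting) length_greater_0_conv mem_Collect_eq orbit_altdef)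
  show "set r \<subseteq> orbit w (hd r)"
    using hd by (auto simp: in_set_conv_nth cyclic_list_nth[OF assms(1)] funpow_in_orbit)
qed

text \<open>Once the first entry is fixed, there is only one way to write a cycle. Hence
  \<open>hd\<close> turns counts of written cycles into counts of elements.\<close>

lemma cyclic_list_unique:
  assumes "map w r = rotate1 r" "map w q = rotate1 q" "distinct r" "distinct q" "r \<noteq> []" "q \<noteq> []" "hd r = hd q"
  shows "r = q"
proof (rule nth_equalityI)
  have "set r = set q" using assms by (simp add: set_cyclic_list)
  then show *: "length r = length q" using assms by (metis distinct_card)
  fix i assume "i < length r"
  then show "r ! i = q ! i" using assms * by (simp add: cyclic_list_nth)
qed

lemma cyclic_list_exists:
  assumes "w permutes X" "finite X"
  obtains r where "distinct r" "r \<noteq> []" "hd r = x" "map w r = rotate1 r"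
proof -
  have perm: "permutation w" using assms permutation_permutes by blast
  let ?r = "support w x" and ?L = "least_power w x"
  have L: "?L > 0" "(w ^^ ?L) x = x" using least_power_of_permutation[OF perm] by auto
  have "map w ?r = rotate1 ?r"
  proof (rule nth_equalityI)
    fix i assume "i < length (map w ?r)"
    then have i: "i < ?L" by simp
    show "map w ?r ! i = rotate1 ?r ! i"
    proof (cases "Suc i = ?L")
      case True
      then have "w ((w ^^ i) x) = x" using L by (metis funpow.simps(2) o_apply)
      then show ?thesis using i True L by (simp add: nth_rotate1)
    next
      case False
      then show ?thesis using i by (simp add: nth_rotate1)
    qed
  qed simp
  then show thesis
    using that[of ?r] cycle_of_permutation[OF perm, of x] L by (simp add: hd_map)
qed

lemma sign_cycle_of_list:
  assumes "distinct r" "r \<noteq> []"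
  shows "sign (cycle_of_list r) = (-1) ^ (length r - 1)"
  using assms
proof (induction r rule: cycle_of_list.induct)
  case (1 i j cs)
  then show ?case
    by (simp add: sign_compose permutation_swap_id permutation_of_cycle sign_swap_id del: comp_apply flip: comp_def)
qed (auto simp: sign_id)

text \<open>The engine of all recursions over cycles: composing with the inverse of the cycle
  \<open>r\<close> fixes every entry of \<open>r\<close> and leaves a permutation of the remaining
  points.\<close>

lemma bij_betw_add_cycle:
  assumes "distinct r" "set r \<subseteq> X"
  shows "bij_betw (\<lambda>v. cycle_of_list r \<circ> v) {v. v permutes X - set r}
           {w. w permutes X \<and> map w r = rotate1 r}"
proof (rule bij_betwI[where g = "\<lambda>w. inv (cycle_of_list r) \<circ> w"])
  let ?c = "cycle_of_list r"
  have c: "?c permutes set r" by (rule cycle_permutes)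
  have rot: "map ?c r = rotate1 r" using cyclic_rotation[OF assms(1), of 1] by simp
  show "(\<lambda>v. ?c \<circ> v) \<in> {v. v permutes X - set r} \<rightarrow> {w. w permutes X \<and> map w r = rotate1 r}"
  proof safe
    fix v assume v: "v permutes X - set r"
    show "?c \<circ> v permutes X"
      using permutes_subset[OF c assms(2)] permutes_subset[OF v] by (intro permutes_compose) auto
    have "map (?c \<circ> v) r = map ?c r" using permutes_not_in[OF v] by simp
    then show "map (?c \<circ> v) r = rotate1 r" using rot by simp
  qed
  show "(\<lambda>w. inv ?c \<circ> w) \<in> {w. w permutes X \<and> map w r = rotate1 r} \<rightarrow> {v. v permutes X - set r}"
  proof safe
    fix w assume w: "w permutes X" "map w r = rotate1 r"
    have "inv ?c \<circ> w permutes X"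
      using permutes_compose[OF w(1) permutes_subset[OF permutes_inv[OF c] assms(2)]] .
    moreover have "(inv ?c \<circ> w) x = x" if "x \<in> set r" for x
    proof -
      have "w x = ?c x" using w(2) rot that by (metis map_eq_conv)
      then show ?thesis using permutes_inverses[OF c] by simp
    qed
    ultimately show "inv ?c \<circ> w permutes X - set r"
      by (rule permutes_superset) auto
  qed
qed (simp_all only: o_assoc permutes_inv_o[OF cycle_permutes] id_o)

lemma prod_cyclic_list:
  assumes "distinct r" "map w r = rotate1 r"
  shows "(\<Prod>x\<in>set r. a x (w x)) = cyc_prod a r"
proof -
  have "cyc_prod a r = prod_list (map (\<lambda>x. a x (w x)) r)"
    unfolding cyc_prod_def assms(2)[symmetric] by (simp add: zip_map2 comp_def zip_same_conv_map)
  then show ?thesis using assms(1) by (simp add: prod.distinct_set_conv_list)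
qed

lemma prod_add_cycle:
  assumes "distinct r" "set r \<subseteq> X" "finite X" "v permutes X - set r"
  shows "(\<Prod>x\<in>X. a x ((cycle_of_list r \<circ> v) x)) = cyc_prod a r * (\<Prod>x\<in>X - set r. a x (v x))"
proof -
  let ?w = "cycle_of_list r \<circ> v"
  have "map ?w r = rotate1 r"
    using bij_betwE[OF bij_betw_add_cycle[OF assms(1,2)]] assms(4) by blast
  then have "(\<Prod>x\<in>set r. a x (?w x)) = cyc_prod a r" by (rule prod_cyclic_list[OF assms(1)])
  moreover have "(\<Prod>x\<in>X - set r. a x (?w x)) = (\<Prod>x\<in>X - set r. a x (v x))"
  proof (rule prod.cong[OF refl])
    fix x assume "x \<in> X - set r"
    then have "v x \<notin> set r" using permutes_in_image[OF assms(4), of x] by blast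
    then show "a x (?w x) = a x (v x)" by (simp add: id_outside_supp)
  qed
  moreover have "(\<Prod>x\<in>X. a x (?w x)) = (\<Prod>x\<in>X - set r. a x (?w x)) * (\<Prod>x\<in>set r. a x (?w x))"
    using prod.subset_diff[OF assms(2,3)] .
  ultimately show ?thesis by (simp add: mult.commute)
qed

text \<open>Double counting and the involution run over rows, the Newton identities over the sets of
  their entries; this passes between the two.\<close>

lemma sum_group_orderings:
  assumes "finite X"
  shows "(\<Sum>r | distinct r \<and> set r \<subseteq> X \<and> Q (set r). F r)
       = (\<Sum>C | C \<subseteq> X \<and> Q C. \<Sum>r\<in>permutations_of_set C. F r)"
proof -
  let ?S = "{r. distinct r \<and> set r \<subseteq> X \<and> Q (set r)}" and ?T = "{C. C \<subseteq> X \<and> Q C}"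
  have "finite ?S" by (rule finite_subset[OF _ finite_subset_distinct[OF assms]]) auto
  moreover have "finite ?T" using assms by simp
  ultimately have "sum F ?S = (\<Sum>C\<in>?T. sum F {r \<in> ?S. set r = C})"
    by (intro sum.group[symmetric]) auto
  also have "\<dots> = (\<Sum>C\<in>?T. \<Sum>r\<in>permutations_of_set C. F r)"
    by (intro sum.cong) (auto simp: permutations_of_set_def)
  finally show ?thesis .
qed

text \<open>Newton's identity between elementary symmetric functions and power sums, in its multilinear
  form: mark an element of \<open>X\<close> in each term of the determinant and split off its cycle.\<close>

lemma card_mult_det_on:
  fixes a :: "'a \<Rightarrow> 'a \<Rightarrow> 'b::comm_ring_1"
  assumes "finite X"
  shows "of_nat (card X) * det_on X a =
    (\<Sum>C | C \<subseteq> X \<and> C \<noteq> {}. (-1) ^ (card C - 1) * (\<Sum>r\<in>permutations_of_set C. cyc_prod a r) * det_on (X - C) a)"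
proof -
  define T where "T = (\<lambda>w. of_int (sign w) * (\<Prod>x\<in>X. a x (w x)))"
  let ?R = "{r. distinct r \<and> set r \<subseteq> X \<and> set r \<noteq> {}}"
  have finR: "finite ?R" by (rule finite_subset[OF _ finite_subset_distinct[OF assms]]) auto
  have finP: "finite {w. w permutes X}" using assms by (rule finite_permutations)
  \<comment> \<open>A marked element is recorded as the first entry of its cycle, so the factor
    \<open>card X\<close> is the number of cycles of \<open>w\<close> written as lists.\<close>
  have count: "card {r \<in> ?R. map w r = rotate1 r} = card X" if w: "w permutes X" for w
  proof -
    have "bij_betw hd {r \<in> ?R. map w r = rotate1 r} X"
    proof (rule bij_betw_imageI)
      show "inj_on hd {r \<in> ?R. map w r = rotate1 r}"
        by (rule inj_onI) (use cyclic_list_unique in auto)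
      show "hd ` {r \<in> ?R. map w r = rotate1 r} = X"
      proof
        show "X \<subseteq> hd ` {r \<in> ?R. map w r = rotate1 r}"
        proof
          fix x assume x: "x \<in> X"
          obtain r where r: "distinct r" "r \<noteq> []" "hd r = x" "map w r = rotate1 r"
            using cyclic_list_exists[OF w assms] .
          have "set r \<subseteq> X"
            using set_cyclic_list[OF r(4,2)] permutes_orbit_subset[OF w x] r(3) by simp
          then show "x \<in> hd ` {r \<in> ?R. map w r = rotate1 r}" using r by force
        qed
      qed auto
    qed
    then show ?thesis by (rule bij_betw_same_card)
  qed
  have "of_nat (card X) * det_on X a = (\<Sum>w | w permutes X. of_nat (card X) * T w)"
    by (simp add: det_on_def T_def sum_distrib_left)
  also have "\<dots> = (\<Sum>w | w permutes X. \<Sum>r | r \<in> ?R \<and> map w r = rotate1 r. T w)"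
    using count by (intro sum.cong) auto
  also have "\<dots> = (\<Sum>r\<in>?R. \<Sum>w | w \<in> {w. w permutes X} \<and> map w r = rotate1 r. T w)"
    by (rule sum.swap_restrict[OF finP finR])
  also have "\<dots> = (\<Sum>r\<in>?R. (-1) ^ (card (set r) - 1) * cyc_prod a r * det_on (X - set r) a)"
  proof (rule sum.cong[OF refl])
    fix r assume "r \<in> ?R"
    then have r: "distinct r" "set r \<subseteq> X" "r \<noteq> []" by auto
    have "(\<Sum>w | w \<in> {w. w permutes X} \<and> map w r = rotate1 r. T w) = (\<Sum>v | v permutes X - set r. T (cycle_of_list r \<circ> v))"
      using sum.reindex_bij_betw[OF bij_betw_add_cycle[OF r(1,2)], of T] by simp
    also have "\<dots> = (\<Sum>v | v permutes X - set r.
        (-1) ^ (card (set r) - 1) * cyc_prod a r * (of_int (sign v) * (\<Prod>x\<in>X - set r. a x (v x))))"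
    proof (rule sum.cong[OF refl])
      fix v assume "v \<in> {v. v permutes X - set r}"
      then have v: "v permutes X - set r" by simp
      have "permutation v" using v assms permutation_permutes by blast
      then have "sign (cycle_of_list r \<circ> v) = (-1) ^ (card (set r) - 1) * sign v"
        using sign_compose[OF permutation_of_cycle, of v r] sign_cycle_of_list[OF r(1,3)] r(1)
        by (simp add: distinct_card)
      then show "T (cycle_of_list r \<circ> v) = (-1) ^ (card (set r) - 1) * cyc_prod a r * (of_int (sign v) * (\<Prod>x\<in>X - set r. a x (v x)))"
        unfolding T_def prod_add_cycle[OF r(1,2) assms v] by simp
    qed
    finally show "(\<Sum>w | w \<in> {w. w permutes X} \<and> map w r = rotate1 r. T w) =
       (-1) ^ (card (set r) - 1) * cyc_prod a r * det_on (X - set r) a"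
      by (simp add: det_on_def sum_distrib_left)
  qed
  also have "\<dots> = (\<Sum>C | C \<subseteq> X \<and> C \<noteq> {}. \<Sum>r\<in>permutations_of_set C. (-1) ^ (card (set r) - 1) * cyc_prod a r * det_on (X - set r) a)"
    by (rule sum_group_orderings[OF assms, where Q = "\<lambda>C. C \<noteq> {}"])
  also have "\<dots> = (\<Sum>C | C \<subseteq> X \<and> C \<noteq> {}. (-1) ^ (card C - 1) * (\<Sum>r\<in>permutations_of_set C. cyc_prod a r) * det_on (X - C) a)"
    by (intro sum.cong refl) (auto simp: sum_distrib_left sum_distrib_right permutations_of_set_def intro!: sum.cong)
  finally show ?thesis .
qed

section \<open>Tableaux and permutations\<close>

lemma finite_tableaux:
  assumes "finite X"
  shows "finite (tableaux X lam)"
proof (rule finite_subset)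
  let ?R = "{r. set r \<subseteq> X \<and> distinct r}"
  show "tableaux X lam \<subseteq> {U. set U \<subseteq> ?R \<and> length U = length lam}"
    by (auto simp: tableaux_def distinct_concat_iff)
  show "finite {U. set U \<subseteq> ?R \<and> length U = length lam}"
    by (intro finite_lists_length_eq finite_subset_distinct assms)
qed

lemma tableaux_Nil: "tableaux X [] = (if X = {} then {[]} else {})"
  by (auto simp: tableaux_def)

lemma tableaux_Cons_iff:
  "r # U \<in> tableaux X (l # ls) \<longleftrightarrow>
     length r = l \<and> distinct r \<and> set r \<subseteq> X \<and> U \<in> tableaux (X - set r) ls"
  by (auto simp: tableaux_def)

lemma sum_tableaux_Cons:
  assumes "finite X"
  shows "(\<Sum>U\<in>tableaux X (l # ls). F U) =
    (\<Sum>C | C \<subseteq> X \<and> card C = l. \<Sum>r\<in>permutations_of_set C. \<Sum>U\<in>tableaux (X - C) ls. F (r # U))"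
proof -
  let ?R = "{r. distinct r \<and> set r \<subseteq> X \<and> card (set r) = l}"
  have finR: "finite ?R" by (rule finite_subset[OF _ finite_subset_distinct[OF assms]]) auto
  have "bij_betw (\<lambda>(r, U). r # U) (SIGMA r:?R. tableaux (X - set r) ls) (tableaux X (l # ls))"
  proof (rule bij_betw_imageI)
    show "inj_on (\<lambda>(r, U). r # U) (SIGMA r:?R. tableaux (X - set r) ls)"
      by (auto simp: inj_on_def)
    show "(\<lambda>(r, U). r # U) ` (SIGMA r:?R. tableaux (X - set r) ls) = tableaux X (l # ls)"
    proof (intro equalityI subsetI)
      fix V assume V: "V \<in> tableaux X (l # ls)"
      then obtain r U where "V = r # U" by (cases V) (auto simp: tableaux_def)
      with V show "V \<in> (\<lambda>(r, U). r # U) ` (SIGMA r:?R. tableaux (X - set r) ls)"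
        by (force simp: tableaux_Cons_iff distinct_card)
    qed (auto simp: tableaux_Cons_iff distinct_card)
  qed
  then have "(\<Sum>U\<in>tableaux X (l # ls). F U) = (\<Sum>(r, U)\<in>(SIGMA r:?R. tableaux (X - set r) ls). F (r # U))"
    by (simp add: sum.reindex_bij_betw[symmetric] case_prod_unfold)
  also have "\<dots> = (\<Sum>r\<in>?R. \<Sum>U\<in>tableaux (X - set r) ls. F (r # U))"
    using finR assms by (intro sum.Sigma[symmetric]) (auto intro: finite_tableaux)
  also have "\<dots> = (\<Sum>C | C \<subseteq> X \<and> card C = l. \<Sum>r\<in>permutations_of_set C. \<Sum>U\<in>tableaux (X - set r) ls. F (r # U))"
    by (rule sum_group_orderings[OF assms, where Q = "\<lambda>C. card C = l"])
  also have "\<dots> = (\<Sum>C | C \<subseteq> X \<and> card C = l. \<Sum>r\<in>permutations_of_set C. \<Sum>U\<in>tableaux (X - C) ls. F (r # U))"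
    by (intro sum.cong refl) (auto simp: permutations_of_set_def)
  finally show ?thesis .
qed

text \<open>The reduction to single rows. Once the set of entries of the first row is fixed, its
  orderings and the filling of the other rows are independent, so the sum factors. The absence of
  zero parts keeps these sets nonempty.\<close>

lemma sum_tableaux_prod_cong:
  fixes g g' :: "'a list \<Rightarrow> 'b::comm_semiring_1"
  assumes "finite X" "0 \<notin> set lam"
    and "\<And>C. C \<subseteq> X \<Longrightarrow> C \<noteq> {} \<Longrightarrow> (\<Sum>r\<in>permutations_of_set C. g r) = (\<Sum>r\<in>permutations_of_set C. g' r)"
  shows "(\<Sum>U\<in>tableaux X lam. prod_list (map g U)) = (\<Sum>U\<in>tableaux X lam. prod_list (map g' U))"
  using assms
proof (induction lam arbitrary: X)
  case Nil
  then show ?case by (simp add: tableaux_Nil)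
next
  case (Cons l ls)
  have split: "(\<Sum>U\<in>tableaux X (l # ls). prod_list (map h U)) =
    (\<Sum>C | C \<subseteq> X \<and> card C = l. (\<Sum>r\<in>permutations_of_set C. h r) * (\<Sum>U\<in>tableaux (X - C) ls. prod_list (map h U)))"
    for h :: "'a list \<Rightarrow> 'b"
    unfolding sum_tableaux_Cons[OF Cons.prems(1)] by (simp add: sum_product)
  show ?case unfolding split
  proof (rule sum.cong[OF refl])
    fix C assume "C \<in> {C. C \<subseteq> X \<and> card C = l}"
    then have C: "C \<subseteq> X" "C \<noteq> {}" using Cons.prems(2) by auto
    have "(\<Sum>U\<in>tableaux (X - C) ls. prod_list (map g U)) = (\<Sum>U\<in>tableaux (X - C) ls. prod_list (map g' U))"
      using Cons.prems by (intro Cons.IH) auto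
    then show "(\<Sum>r\<in>permutations_of_set C. g r) * (\<Sum>U\<in>tableaux (X - C) ls. prod_list (map g U)) =
      (\<Sum>r\<in>permutations_of_set C. g' r) * (\<Sum>U\<in>tableaux (X - C) ls. prod_list (map g' U))"
      using Cons.prems(3)[OF C] by simp
  qed
qed

text \<open>The rows exhaust \<open>X\<close>, so exactly one permutation satisfies the condition
  and the sum has one term. Keeping it as a sum allows the induction to split off a cycle, and the
  sums in the immanant to be interchanged, without naming that permutation.\<close>

lemma sum_permutations_cyclic_on_rows:
  fixes a :: "'a \<Rightarrow> 'a \<Rightarrow> 'b::comm_semiring_1"
  assumes "finite X" "distinct (concat V)" "set (concat V) = X"
  shows "(\<Sum>w | w permutes X \<and> (\<forall>r\<in>set V. map w r = rotate1 r). \<Prod>x\<in>X. a x (w x))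
       = prod_list (map (cyc_prod a) V)"
  using assms
proof (induction V arbitrary: X)
  case Nil
  have "{w. w permutes ({} :: 'a set)} = {id}" by auto
  with Nil show ?case by simp
next
  case (Cons r V)
  let ?P = "\<lambda>w. \<forall>q\<in>set V. map w q = rotate1 q"
  have r: "distinct r" "set r \<subseteq> X" and V: "distinct (concat V)" "set (concat V) = X - set r"
    using Cons.prems by auto
  have rows: "?P (cycle_of_list r \<circ> v) \<longleftrightarrow> ?P v" if v: "v permutes X - set r" for v
  proof -
    have "map (cycle_of_list r \<circ> v) q = map v q" if "q \<in> set V" for q
    proof -
      have "set q \<subseteq> X - set r" using that V by auto
      then have "v x \<notin> set r" if "x \<in> set q" for x
        using permutes_in_image[OF v, of x] that by blast
      then show ?thesis by (simp add: id_outside_supp)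
    qed
    then show ?thesis by (intro ball_cong refl) metis
  qed
  have bij: "bij_betw (\<lambda>v. cycle_of_list r \<circ> v) {v. v permutes X - set r \<and> ?P v}
          {w. w permutes X \<and> (\<forall>q\<in>set (r # V). map w q = rotate1 q)}"
  proof -
    have "bij_betw (\<lambda>v. cycle_of_list r \<circ> v) {v \<in> {v. v permutes X - set r}. ?P v}
          {w \<in> {w. w permutes X \<and> map w r = rotate1 r}. ?P w}"
      using rows by (intro bij_betw_Collect[OF bij_betw_add_cycle[OF r]]) auto
    then show ?thesis by (simp add: Collect_conj_eq Int_assoc)
  qed
  have "(\<Sum>w | w permutes X \<and> (\<forall>q\<in>set (r # V). map w q = rotate1 q). \<Prod>x\<in>X. a x (w x))
      = (\<Sum>v | v permutes X - set r \<and> ?P v. \<Prod>x\<in>X. a x ((cycle_of_list r \<circ> v) x))"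
    by (rule sum.reindex_bij_betw[OF bij, symmetric])
  also have "\<dots> = (\<Sum>v | v permutes X - set r \<and> ?P v. cyc_prod a r * (\<Prod>x\<in>X - set r. a x (v x)))"
    using prod_add_cycle[OF r Cons.prems(1)] by (intro sum.cong) auto
  also have "\<dots> = cyc_prod a r * (\<Sum>v | v permutes X - set r \<and> ?P v. \<Prod>x\<in>X - set r. a x (v x))"
    by (simp add: sum_distrib_left)
  also have "(\<Sum>v | v permutes X - set r \<and> ?P v. \<Prod>x\<in>X - set r. a x (v x)) = prod_list (map (cyc_prod a) V)"
    using Cons.prems(1) V by (intro Cons.IH) auto
  finally show ?case by simp
qed

text \<open>Counts the possible first entries of a row of length \<open>l\<close>. Since
  \<open>w\<close> maps \<open>X\<close> into itself, \<open>X\<close> is a union of whole orbits,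
  and each orbit of size \<open>l\<close> supplies \<open>l\<close> entries.\<close>

lemma card_orbits_of_size:
  assumes "w permutes Y" "finite Y" "X \<subseteq> Y" "w ` X \<subseteq> X"
  shows "card {x \<in> X. card (orbit w x) = l} = l * count (image_mset card (mset_set (orbit w ` X))) l"
proof -
  have finX: "finite X" using assms finite_subset by blast
  have perm: "permutation w" using assms permutation_permutes by blast
  have sub: "orbit w x \<subseteq> X" if "x \<in> X" for x
  proof
    fix y assume "y \<in> orbit w x"
    then show "y \<in> X" by induction (use assms that in auto)
  qed
  have self: "x \<in> orbit w x" for x by (rule permutation_self_in_orbit[OF perm])
  have eq: "orbit w y = orbit w x" if "y \<in> orbit w x" for x y
    using orbit_cyclic_eq3[OF cyclic_on_orbit'[OF perm] that] .
  let ?Q = "{Q \<in> orbit w ` X. card Q = l}"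
  have "{x \<in> X. card (orbit w x) = l} = \<Union> ?Q"
    using sub self eq by (auto simp: subset_iff)
  also have "card \<dots> = sum card ?Q"
  proof (rule card_Union_disjoint)
    show "pairwise disjnt ?Q"
      unfolding pairwise_def disjnt_def using eq by blast
    show "\<And>Q. Q \<in> ?Q \<Longrightarrow> finite Q" using sub finX finite_subset by blast
  qed
  also have "\<dots> = l * card ?Q" by simp
  also have "card ?Q = count (image_mset card (mset_set (orbit w ` X))) l"
  proof -
    have "count (image_mset card (mset_set (orbit w ` X))) l = size {#Q \<in># mset_set (orbit w ` X). card Q = l#}"
      by (auto simp: count_image_mset' size_multiset_overloaded_eq intro!: sum.cong)
    also have "\<dots> = card ?Q" using finX by (simp add: filter_mset_mset_set)
    finally show ?thesis ..
  qed
  finally show ?thesis .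
qed

text \<open>The first row is determined by its first entry, which can be any element of any orbit of
  length \<open>l\<close>. The choices of the element build up the product of the parts, the choices
  of the orbit the factorials of the multiplicities. The set \<open>X\<close> is a variable closed
  under \<open>w\<close> so that the induction can discard the orbit used.\<close>

lemma card_cyclic_tableaux:
  assumes "w permutes Y" "finite Y" "X \<subseteq> Y" "w ` X \<subseteq> X" "0 \<notin> set lam"
  shows "card {V \<in> tableaux X lam. \<forall>r\<in>set V. map w r = rotate1 r} =
    (if image_mset card (mset_set (orbit w ` X)) = mset lam
     then prod_list lam * (\<Prod>i\<in>set lam. fact (count_list lam i)) else 0)"
  using assms(3-5)
proof (induction lam arbitrary: X)
  case Nil
  have "finite (orbit w ` X)" using assms(2) Nil finite_subset by blast
  moreover have "{V \<in> {[]}. \<forall>r\<in>set V. map w r = rotate1 r} = {[]}" by auto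
  ultimately show ?case by (simp add: tableaux_Nil mset_set_empty_iff)
next
  case (Cons l ls)
  let ?P = "\<lambda>V. \<forall>r\<in>set V. map w r = rotate1 r"
  let ?type = "\<lambda>X. image_mset card (mset_set (orbit w ` X))"
  let ?z = "\<lambda>lam. prod_list lam * (\<Prod>i\<in>set lam. fact (count_list lam i)) :: nat"
  have finX: "finite X" using assms(2) Cons.prems finite_subset by blast
  have perm: "permutation w" using assms permutation_permutes by blast
  have sub: "orbit w x \<subseteq> X" if "x \<in> X" for x
  proof
    fix y assume "y \<in> orbit w x"
    then show "y \<in> X" by induction (use Cons.prems that in auto)
  qed
  have self: "x \<in> orbit w x" for x by (rule permutation_self_in_orbit[OF perm])
  have eq: "orbit w y = orbit w x" if "y \<in> orbit w x" for x y
    using orbit_cyclic_eq3[OF cyclic_on_orbit'[OF perm] that] .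
  have l: "l > 0" using Cons.prems by auto
  let ?R = "{r. distinct r \<and> set r \<subseteq> X \<and> length r = l \<and> map w r = rotate1 r}"
  have finR: "finite ?R" by (rule finite_subset[OF _ finite_subset_distinct[OF finX]]) auto
  have bij: "bij_betw hd ?R {x \<in> X. card (orbit w x) = l}"
  proof (rule bij_betw_imageI)
    show "inj_on hd ?R"
    proof (rule inj_onI)
      fix r q assume rq: "r \<in> ?R" "q \<in> ?R" "hd r = hd q"
      then have "r \<noteq> []" "q \<noteq> []" using l by auto
      then show "r = q" using rq cyclic_list_unique[of w r q] by auto
    qed
    show "hd ` ?R = {x \<in> X. card (orbit w x) = l}"
    proof (intro equalityI subsetI)
      fix x assume "x \<in> hd ` ?R"
      then obtain r where r: "distinct r" "set r \<subseteq> X" "length r = l" "map w r = rotate1 r" "x = hd r" by auto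
      then have "r \<noteq> []" using l by auto
      then show "x \<in> {x \<in> X. card (orbit w x) = l}"
        using r set_cyclic_list[OF r(4)] by (metis (mono_tags, lifting) distinct_card hd_in_set mem_Collect_eq subsetD)
    next
      fix x assume x: "x \<in> {x \<in> X. card (orbit w x) = l}"
      obtain r where r: "distinct r" "r \<noteq> []" "hd r = x" "map w r = rotate1 r"
        using cyclic_list_exists[OF assms(1,2)] .
      then have "set r = orbit w x" using set_cyclic_list by metis
      then have "r \<in> ?R" using r x sub by (auto simp flip: distinct_card)
      then show "x \<in> hd ` ?R" using r(3) by force
    qed
  qed
  have type_diff: "?type X = add_mset (card (orbit w x)) (?type (X - orbit w x))" if x: "x \<in> X" for x
  proof -
    have "orbit w ` X = insert (orbit w x) (orbit w ` (X - orbit w x))"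
    proof (intro equalityI subsetI)
      fix Q assume "Q \<in> orbit w ` X"
      then obtain y where "y \<in> X" "Q = orbit w y" by auto
      then show "Q \<in> insert (orbit w x) (orbit w ` (X - orbit w x))" using eq by (cases "y \<in> orbit w x") auto
    qed (use x in auto)
    moreover have "orbit w x \<notin> orbit w ` (X - orbit w x)" using self by auto
    ultimately show ?thesis using finX by simp
  qed
  have closed: "w ` (X - orbit w x) \<subseteq> X - orbit w x" for x
  proof -
    have "y \<in> orbit w x" if "w y \<in> orbit w x" for y
      using eq[OF that] orbit.base[of w y] self by (metis eq that)
    then show ?thesis using Cons.prems(2) by auto
  qed
  have "{V \<in> tableaux X (l # ls). ?P V} = (\<lambda>(r, V). r # V) ` (SIGMA r:?R. {V \<in> tableaux (X - set r) ls. ?P V})"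
  proof (intro equalityI subsetI)
    fix V assume V: "V \<in> {V \<in> tableaux X (l # ls). ?P V}"
    then obtain r U where "V = r # U" by (cases V) (auto simp: tableaux_def)
    with V show "V \<in> (\<lambda>(r, V). r # V) ` (SIGMA r:?R. {V \<in> tableaux (X - set r) ls. ?P V})"
      by (force simp: tableaux_Cons_iff)
  qed (auto simp: tableaux_Cons_iff)
  moreover have "inj_on (\<lambda>(r, V). r # V) (SIGMA r:?R. {V \<in> tableaux (X - set r) ls. ?P V})"
    by (auto simp: inj_on_def)
  ultimately have "card {V \<in> tableaux X (l # ls). ?P V} = card (SIGMA r:?R. {V \<in> tableaux (X - set r) ls. ?P V})"
    by (simp add: card_image)
  also have "\<dots> = (\<Sum>r\<in>?R. card {V \<in> tableaux (X - set r) ls. ?P V})"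
    using finR finX by (intro card_SigmaI) (simp_all add: finite_tableaux)
  \<comment> \<open>Removing the orbit of the first row removes one \<open>l\<close> from the type
    of \<open>X\<close>, so the remaining count is the same for every possible first row.\<close>
  also have "\<dots> = (\<Sum>r\<in>?R. if ?type X = mset (l # ls) then ?z ls else 0)"
  proof (rule sum.cong[OF refl])
    fix r assume r: "r \<in> ?R"
    then have "r \<noteq> []" using l by auto
    then have set: "set r = orbit w (hd r)" and hd: "hd r \<in> X" using r set_cyclic_list by auto
    have "card (orbit w (hd r)) = l" using bij_betwE[OF bij] r by auto
    then have "?type X = mset (l # ls) \<longleftrightarrow> ?type (X - set r) = mset ls"
      using type_diff[OF hd] set by auto
    moreover have "card {V \<in> tableaux (X - set r) ls. ?P V} = (if ?type (X - set r) = mset ls then ?z ls else 0)"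
      unfolding set using Cons.prems closed by (intro Cons.IH) auto
    ultimately show "card {V \<in> tableaux (X - set r) ls. ?P V} = (if ?type X = mset (l # ls) then ?z ls else 0)"
      by simp
  qed
  also have "\<dots> = (if ?type X = mset (l # ls) then card ?R * ?z ls else 0)" by simp
  also have "card ?R = l * count (?type X) l"
    using bij_betw_same_card[OF bij] card_orbits_of_size[OF assms(1,2) Cons.prems(1,2)] by simp
  also have "(if ?type X = mset (l # ls) then l * count (?type X) l * ?z ls else 0) =
     (if ?type X = mset (l # ls) then ?z (l # ls) else 0)"
  proof -
    \<comment> \<open>With \<open>k\<close> the multiplicity of \<open>l\<close> in
      \<open>ls\<close>, this is \<open>fact (Suc k) = Suc k * fact k\<close>; the factor
      \<open>Suc k\<close> is the number of orbits available to the first row.\<close>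
    have z: "(\<Prod>i\<in>set (l # ls). fact (count_list (l # ls) i)) =
       Suc (count_list ls l) * (\<Prod>i\<in>set ls. fact (count_list ls i) :: nat)"
    proof -
      have *: "(\<Prod>i\<in>set (l # ls). fact (count_list (l # ls) i)) =
        fact (Suc (count_list ls l)) * (\<Prod>i\<in>set ls - {l}. fact (count_list ls i) :: nat)"
        by (simp add: prod.insert_remove)
      show ?thesis
      proof (cases "l \<in> set ls")
        case True
        then show ?thesis unfolding * by (simp add: prod.remove[of "set ls" l] algebra_simps)
      next
        case False
        then show ?thesis unfolding * by (simp add: count_list_0_iff)
      qed
    qed
    have c: "count (mset (l # ls)) l = Suc (count_list ls l)"
      by (simp add: count_mset count_list_eq_length_filter)
    show ?thesis
    proof (cases "?type X = mset (l # ls)")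
      case True
      show ?thesis unfolding True z c prod_list.Cons by (simp only: mult.assoc mult.left_commute)
    qed simp
  qed
  finally show ?case .
qed

text \<open>Numbers that are not parts contribute \<open>fact 0\<close>. The product over
  \<open>set lam\<close> is the form suited to induction on the list.\<close>

lemma z_partition_eq:
  assumes "0 \<notin> set lam"
  shows "z_partition lam = prod_list lam * (\<Prod>i\<in>set lam. fact (count_list lam i))"
proof -
  have "set lam \<subseteq> {1..sum_list lam}"
  proof
    fix i assume i: "i \<in> set lam"
    then have "i \<noteq> 0" using assms by metis
    then show "i \<in> {1..sum_list lam}" using i by (simp add: member_le_sum_list)
  qed
  then have "(\<Prod>i\<in>set lam. fact (count_list lam i)) = (\<Prod>i=1..sum_list lam. fact (count_list lam i) :: nat)"
    by (intro prod.mono_neutral_left) (auto simp: count_list_0_iff)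
  then show ?thesis by (simp add: z_partition_def)
qed

lemma card_cyclic_tableaux_psi:
  assumes "w permutes {1..n}" "lam \<turnstile> n"
  shows "real (card {V \<in> tableaux {1..n} lam. \<forall>r\<in>set V. map w r = rotate1 r}) = psi lam w"
  using card_cyclic_tableaux[OF assms(1), of "{1..n}" lam] permutes_image[OF assms(1)] assms(2) z_partition_eq[of lam]
  by (simp add: is_partition_def psi_def cycle_type_def)

lemma immanant_psi_eq:
  assumes "lam \<turnstile> n"
  shows "immanant n (psi lam) a = (\<Sum>V\<in>tableaux {1..n} lam. prod_list (map (cyc_prod a) V))"
proof -
  let ?P = "\<lambda>w V. \<forall>r\<in>set V. map w r = rotate1 r"
  have "immanant n (psi lam) a = (\<Sum>w | w permutes {1..n}. \<Sum>V | V \<in> tableaux {1..n} lam \<and> ?P w V. \<Prod>i=1..n. a i (w i))"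
    unfolding immanant_def using card_cyclic_tableaux_psi[OF _ assms, symmetric] by (intro sum.cong) auto
  also have "\<dots> = (\<Sum>V\<in>tableaux {1..n} lam. \<Sum>w | w \<in> {w. w permutes {1..n}} \<and> ?P w V. \<Prod>i=1..n. a i (w i))"
    by (subst sum.swap_restrict[symmetric]) (auto intro: finite_tableaux finite_permutations)
  also have "\<dots> = (\<Sum>V\<in>tableaux {1..n} lam. prod_list (map (cyc_prod a) V))"
    by (intro sum.cong refl) (simp add: sum_permutations_cyclic_on_rows tableaux_def)
  finally show ?thesis .
qed

section \<open>Semistrict orderings of a finite poset\<close>

text \<open>All posets below are naturally labelled, that is, \<open>lt x y\<close> implies
  \<open>x < y\<close>. A chain therefore has to be tested only on increasing pairs of
  labels.\<close>

definition chain_on :: "('a::linorder \<Rightarrow> 'a \<Rightarrow> bool) \<Rightarrow> 'a set \<Rightarrow> bool" where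
  "chain_on lt X \<longleftrightarrow> (\<forall>x\<in>X. \<forall>y\<in>X. x < y \<longrightarrow> lt x y)"

text \<open>Because \<open>E {} = 1\<close>, the term \<open>C = B\<close> is the unknown value up
  to sign, and all other terms concern proper subsets; no division occurs. The bound
  \<open>X\<close> is present because the recursions are available only for index sets inside
  \<open>{1..n}\<close>.\<close>

lemma newton_recursion_unique:
  fixes P Q E :: "'a set \<Rightarrow> 'b::comm_ring_1"
  assumes "finite B" "B \<noteq> {}" "E {} = 1"
    and "\<And>B. finite B \<Longrightarrow> B \<noteq> {} \<Longrightarrow> B \<subseteq> X \<Longrightarrow>
      (\<Sum>C | C \<subseteq> B \<and> C \<noteq> {}. (-1) ^ (card C - 1) * P C * E (B - C)) =
      (\<Sum>C | C \<subseteq> B \<and> C \<noteq> {}. (-1) ^ (card C - 1) * Q C * E (B - C))"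
    and "B \<subseteq> X"
  shows "P B = Q B"
  using assms(1,2,5)
proof (induction B rule: finite_psubset_induct)
  case (psubset B)
  have "{C. C \<subseteq> B \<and> C \<noteq> {}} = insert B {C. C \<subset> B \<and> C \<noteq> {}}" using psubset.prems by auto
  moreover have "finite {C. C \<subset> B \<and> C \<noteq> {}}"
    using psubset.hyps by (auto intro: finite_subset[OF _ finite_Collect_subsets])
  ultimately have split: "(\<Sum>C | C \<subseteq> B \<and> C \<noteq> {}. (-1) ^ (card C - 1) * R C * E (B - C)) =
     (-1) ^ (card B - 1) * R B + (\<Sum>C | C \<subset> B \<and> C \<noteq> {}. (-1) ^ (card C - 1) * R C * E (B - C))" for R
    by (simp add: assms(3))
  have "(\<Sum>C | C \<subset> B \<and> C \<noteq> {}. (-1) ^ (card C - 1) * P C * E (B - C)) =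
        (\<Sum>C | C \<subset> B \<and> C \<noteq> {}. (-1) ^ (card C - 1) * Q C * E (B - C))"
  proof (rule sum.cong[OF refl])
    fix C assume "C \<in> {C. C \<subset> B \<and> C \<noteq> {}}"
    then have "P C = Q C" using psubset.IH[of C] psubset.prems by auto
    then show "(-1) ^ (card C - 1) * P C * E (B - C) = (-1) ^ (card C - 1) * Q C * E (B - C)" by simp
  qed
  then have "(-1) ^ (card B - 1) * P B = (-1) ^ (card B - 1) * Q B"
    using assms(4)[OF psubset.hyps psubset.prems] unfolding split by simp
  then have "(-1) ^ (card B - 1) * ((-1) ^ (card B - 1) * P B) = (-1) ^ (card B - 1) * ((-1) ^ (card B - 1) * Q B)"
    by simp
  then show ?case by (simp flip: mult.assoc power_mult_distrib)
qed

section \<open>The determinant of the relation "not greater"\<close>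

text \<open>Subtracting row \<open>p\<close> from row \<open>m\<close> leaves the single entry
  \<open>c\<close>, on the diagonal, and the determinant is expanded along it.\<close>

lemma det_on_split_row:
  fixes a :: "'a \<Rightarrow> 'a \<Rightarrow> real"
  assumes "finite C" "m \<in> C" "p \<in> C" "m \<noteq> p"
    and row: "\<And>y. y \<in> C \<Longrightarrow> a m y = (if y = m then c else 0) + a p y"
  shows "det_on C a = c * det_on (C - {m}) a"
proof -
  let ?S = "\<lambda>f. \<Sum>w | w permutes C. of_int (sign w) * (f (w m) * (\<Prod>x\<in>C - {m}. a x (w x)))"
  have finP: "finite {w. w permutes C}" using assms(1) by (rule finite_permutations)
  have eq: "det_on C a = ?S (a m)"
    unfolding det_on_def using assms(1,2) by (simp add: prod.remove)
  also have "\<dots> = (\<Sum>w | w permutes C. of_int (sign w) * ((if w m = m then c else 0) * (\<Prod>x\<in>C - {m}. a x (w x)))) + ?S (a p)"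
    unfolding sum.distrib[symmetric]
    using assms(2) row by (intro sum.cong) (auto simp: permutes_in_image algebra_simps)
  \<comment> \<open>A determinant with two equal rows: composing each permutation with the
    transposition of \<open>m\<close> and \<open>p\<close> changes the sign of its term
    only.\<close>
  also have "?S (a p) = 0"
  proof -
    let ?t = "Transposition.transpose m p"
    have t: "?t permutes C" using assms by (intro permutes_swap_id)
    have "?S (a p) = (\<Sum>w | w permutes C. - (of_int (sign w) * (a p (w m) * (\<Prod>x\<in>C - {m}. a x (w x)))))"
    proof (rule sum.reindex_bij_witness[of _ "\<lambda>w. w \<circ> ?t" "\<lambda>w. w \<circ> ?t"])
      fix w assume "w \<in> {w. w permutes C}"
      then have w: "w permutes C" by simp
      then have "permutation w" using assms(1) permutation_permutes by blast
      then have sg: "sign (w \<circ> ?t) = - sign w"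
        using assms(4) by (simp add: sign_compose permutation_swap_id sign_swap_id)
      have "(\<Prod>x\<in>C - {m}. a x ((w \<circ> ?t) x)) = a p (w m) * (\<Prod>x\<in>C - {m} - {p}. a x (w x))"
        using assms by (subst prod.remove[of _ p]) (auto intro!: prod.cong simp: Transposition.transpose_def)
      moreover have "(\<Prod>x\<in>C - {m}. a x (w x)) = a p (w p) * (\<Prod>x\<in>C - {m} - {p}. a x (w x))"
        using assms by (subst prod.remove[of _ p]) auto
      ultimately show "- (of_int (sign (w \<circ> ?t)) * (a p ((w \<circ> ?t) m) * (\<Prod>x\<in>C - {m}. a x ((w \<circ> ?t) x))))
         = of_int (sign w) * (a p (w m) * (\<Prod>x\<in>C - {m}. a x (w x)))"
        unfolding sg by simp
    qed (auto simp: t comp_assoc intro: permutes_compose)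
    then show ?thesis by (simp add: sum_negf)
  qed
  also have "(\<Sum>w | w permutes C. of_int (sign w) * ((if w m = m then c else 0) * (\<Prod>x\<in>C - {m}. a x (w x))))
     = (\<Sum>w | w permutes C - {m}. of_int (sign w) * (c * (\<Prod>x\<in>C - {m}. a x (w x))))"
  proof (rule sum.mono_neutral_cong_right[OF finP])
    show "{w. w permutes C - {m}} \<subseteq> {w. w permutes C}" by (auto intro: permutes_subset)
    show "\<forall>w\<in>{w. w permutes C} - {w. w permutes C - {m}}.
       of_int (sign w) * ((if w m = m then c else 0) * (\<Prod>x\<in>C - {m}. a x (w x))) = 0"
    proof
      fix w assume "w \<in> {w. w permutes C} - {w. w permutes C - {m}}"
      then have "w m \<noteq> m" using permutes_superset[of w C "C - {m}"] by auto
      then show "of_int (sign w) * ((if w m = m then c else 0) * (\<Prod>x\<in>C - {m}. a x (w x))) = 0" by simp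
    qed
  qed (auto simp: permutes_not_in)
  also have "\<dots> = c * det_on (C - {m}) a"
    by (simp add: det_on_def sum_distrib_left mult_ac)
  finally show ?thesis by simp
qed

lemma det_on_empty [simp]: "det_on {} a = 1"
proof -
  have "{w. w permutes ({} :: 'a set)} = {id}" by auto
  then show ?thesis by (simp add: det_on_def sign_id)
qed

lemma det_on_singleton [simp]: "det_on {x} a = a x x"
proof -
  have "{w. w permutes {x}} = {id}" by auto
  then show ?thesis by (simp add: det_on_def sign_id)
qed

text \<open>The rows of the two smallest elements differ in at most one column.\<close>

lemma det_on_not_greater:
  fixes lt :: "'a::linorder \<Rightarrow> 'a \<Rightarrow> bool"
  assumes less: "\<And>x y. lt x y \<Longrightarrow> x < y" and trans: "transp lt" and "finite C"
  shows "det_on C (\<lambda>x y. if lt y x then 0 else 1 :: real) = of_bool (chain_on lt C)"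
  using assms(3)
proof (induction C rule: finite_psubset_induct)
  case (psubset C)
  let ?M = "\<lambda>x y. if lt y x then 0 else 1 :: real"
  have irr: "\<not> lt x x" for x using less[of x x] by auto
  show ?case
  proof (cases "C = {}")
    case True
    then show ?thesis by (simp add: chain_on_def)
  next
    case False
    define m where "m = Min C"
    have m: "m \<in> C" "\<And>y. y \<in> C \<Longrightarrow> m \<le> y" using psubset.hyps False by (auto simp: m_def)
    show ?thesis
    proof (cases "C = {m}")
      case True
      then show ?thesis by (simp add: chain_on_def irr)
    next
      case False
      define p where "p = Min (C - {m})"
      have ne: "C - {m} \<noteq> {}" using False m by auto
      have p: "p \<in> C - {m}"
        unfolding p_def using psubset.hyps ne by (intro Min_in) auto
      have p_le: "p \<le> y" if "y \<in> C - {m}" for y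
        unfolding p_def using psubset.hyps that by (intro Min_le) auto
      \<comment> \<open>Nothing lies below the least element \<open>m\<close>, so its row consists
        of ones; only \<open>m\<close> can lie below \<open>p\<close>, so row \<open>p\<close> has
        at most one zero, in column \<open>m\<close>.\<close>
      have row: "?M m y = (if y = m then of_bool (lt m p) else 0) + ?M p y" if "y \<in> C" for y
      proof (cases "y = m")
        case False
        then have "\<not> lt y m" "\<not> lt y p"
          using that m(2)[of y] p_le[of y] less[of y m] less[of y p] by (auto dest: leD)
        then show ?thesis using False by simp
      qed (simp add: irr)
      have "det_on C ?M = of_bool (lt m p) * det_on (C - {m}) ?M"
        using psubset.hyps m p row by (intro det_on_split_row[where p = p]) auto
      also have "det_on (C - {m}) ?M = of_bool (chain_on lt (C - {m}))"
        using m by (intro psubset.IH) auto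
      also have "of_bool (lt m p) * of_bool (chain_on lt (C - {m})) = (of_bool (chain_on lt C) :: real)"
      proof -
        \<comment> \<open>It suffices that \<open>m\<close> lies below \<open>p\<close>: the latter
          is the least of the remaining chain, and transitivity puts \<open>m\<close> below all the
          others.\<close>
        have "chain_on lt C" if h: "lt m p" "chain_on lt (C - {m})"
          unfolding chain_on_def
        proof (intro ballI impI)
          fix x y assume xy: "x \<in> C" "y \<in> C" "x < y"
          then have "y \<noteq> m" using m(2)[of x] by auto
          show "lt x y"
          proof (cases "x = m")
            case True
            show ?thesis
            proof (cases "y = p")
              case False
              then have "p < y" using p_le[of y] xy \<open>y \<noteq> m\<close> by auto
              then have "lt p y" using h(2) p xy \<open>y \<noteq> m\<close> by (auto simp: chain_on_def)
              then show ?thesis using h(1) True trans by (auto dest: transpD)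
            qed (use True h in simp)
          qed (use h xy \<open>y \<noteq> m\<close> in \<open>auto simp: chain_on_def\<close>)
        qed
        moreover have "lt m p \<and> chain_on lt (C - {m})" if "chain_on lt C"
          using that m p by (auto simp: chain_on_def order.not_eq_order_implies_strict)
        ultimately show ?thesis by (auto simp: of_bool_def)
      qed
      finally show ?thesis .
    qed
  qed
qed

lemma prod_list_if_zero_one:
  "prod_list (map (\<lambda>x. if P x then 0 else 1 :: real) xs) = of_bool (\<forall>x\<in>set xs. \<not> P x)"
  by (induction xs) auto

lemma cyc_prod_not_greater:
  "cyc_prod (\<lambda>x y. if lt y x then 0 else 1 :: real) r
     = of_bool (\<forall>j<length r. \<not> lt (rotate1 r ! j) (r ! j))"
proof -
  have "cyc_prod (\<lambda>x y. if lt y x then 0 else 1 :: real) r =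
     prod_list (map (\<lambda>(x, y). if lt y x then 0 else 1) (zip r (rotate1 r)))"
    by (simp add: cyc_prod_def)
  also have "\<dots> = of_bool (\<forall>(x, y)\<in>set (zip r (rotate1 r)). \<not> lt y x)"
    unfolding case_prod_unfold by (rule prod_list_if_zero_one)
  also have "(\<forall>(x, y)\<in>set (zip r (rotate1 r)). \<not> lt y x) \<longleftrightarrow> (\<forall>j<length r. \<not> lt (rotate1 r ! j) (r ! j))"
    by (auto simp: set_zip)
  finally show ?thesis .
qed

lemma cyclically_row_semistrict_single:
  assumes "r \<noteq> []"
  shows "cyclically_row_semistrict lt [r] \<longleftrightarrow> (\<forall>j<length r. \<not> lt (rotate1 r ! j) (r ! j))"
proof -
  obtain k where k: "length r = Suc k" using assms by (cases r) auto
  have "rotate1 r ! j = r ! Suc j" if "j < k" for j using that k by (simp add: nth_rotate1)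
  moreover have "rotate1 r ! k = hd r" using k assms by (simp add: nth_rotate1 hd_conv_nth)
  moreover have "last r = r ! k" using k assms by (simp add: last_conv_nth)
  ultimately have "cyclically_row_semistrict lt [r] \<longleftrightarrow>
      (\<forall>j<k. \<not> lt (rotate1 r ! j) (r ! j)) \<and> \<not> lt (rotate1 r ! k) (r ! k)"
    by (simp add: cyclically_row_semistrict_def row_semistrict_def k)
  then show ?thesis by (simp add: k All_less_Suc conj_commute)
qed

lemma card_mult_chain_cyclic:
  fixes lt :: "'a::linorder \<Rightarrow> 'a \<Rightarrow> bool"
  assumes less: "\<And>x y. lt x y \<Longrightarrow> x < y" and trans: "transp lt" and "finite B"
  shows "real (card B) * of_bool (chain_on lt B) =
    (\<Sum>C | C \<subseteq> B \<and> C \<noteq> {}. (-1) ^ (card C - 1) *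
       (\<Sum>r\<in>permutations_of_set C. of_bool (cyclically_row_semistrict lt [r])) * of_bool (chain_on lt (B - C)))"
proof -
  let ?M = "\<lambda>x y. if lt y x then 0 else 1 :: real"
  have "real (card B) * of_bool (chain_on lt B) = real (card B) * det_on B ?M"
    using det_on_not_greater[OF less trans assms(3)] by simp
  also have "\<dots> = (\<Sum>C | C \<subseteq> B \<and> C \<noteq> {}. (-1) ^ (card C - 1) *
       (\<Sum>r\<in>permutations_of_set C. cyc_prod ?M r) * det_on (B - C) ?M)"
    by (rule card_mult_det_on[OF assms(3)])
  also have "\<dots> = (\<Sum>C | C \<subseteq> B \<and> C \<noteq> {}. (-1) ^ (card C - 1) *
       (\<Sum>r\<in>permutations_of_set C. of_bool (cyclically_row_semistrict lt [r])) * of_bool (chain_on lt (B - C)))"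
  proof (rule sum.cong[OF refl])
    fix C assume C: "C \<in> {C. C \<subseteq> B \<and> C \<noteq> {}}"
    have "(\<Sum>r\<in>permutations_of_set C. cyc_prod ?M r) =
        (\<Sum>r\<in>permutations_of_set C. of_bool (cyclically_row_semistrict lt [r]))"
    proof (rule sum.cong[OF refl])
      fix r assume "r \<in> permutations_of_set C"
      then have "r \<noteq> []" using C by (auto simp: permutations_of_set_def)
      then show "cyc_prod ?M r = of_bool (cyclically_row_semistrict lt [r])"
        by (simp add: cyc_prod_not_greater cyclically_row_semistrict_single)
    qed
    moreover have "det_on (B - C) ?M = of_bool (chain_on lt (B - C))"
      using det_on_not_greater[OF less trans, of "B - C"] assms(3) by simp
    ultimately show "(-1) ^ (card C - 1) * (\<Sum>r\<in>permutations_of_set C. cyc_prod ?M r) * det_on (B - C) ?M =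
      (-1) ^ (card C - 1) * (\<Sum>r\<in>permutations_of_set C. of_bool (cyclically_row_semistrict lt [r])) * of_bool (chain_on lt (B - C))"
      by simp
  qed
  finally show ?thesis .
qed

section \<open>Record-free semistrict orderings\<close>

text \<open>The involution works at the end of a row. Appending an entry adds exactly one test to
  semistrictness and, as shown next, one to record-freeness.\<close>

lemma row_semistrict_snoc:
  "row_semistrict lt [q @ [y]] \<longleftrightarrow> row_semistrict lt [q] \<and> (q \<noteq> [] \<longrightarrow> \<not> lt y (last q))"
proof (cases q rule: rev_cases)
  case (snoc p x)
  show ?thesis unfolding row_semistrict_def snoc
    by (auto simp: nth_append less_Suc_eq all_conj_distrib split: if_splits)
qed (simp add: row_semistrict_def)

lemma record_free_single:
  "record_free lt [r] \<longleftrightarrow> (\<forall>j<length r. 0 < j \<longrightarrow> \<not> (\<forall>k<j. lt (r ! k) (r ! j)))"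
  by (auto simp: record_free_def)

lemma record_free_snoc:
  "record_free lt [q @ [y]] \<longleftrightarrow> record_free lt [q] \<and> (q \<noteq> [] \<longrightarrow> \<not> (\<forall>z\<in>set q. lt z y))"
proof -
  have "(\<forall>j<length q. 0 < j \<longrightarrow> \<not> (\<forall>k<j. lt ((q @ [y]) ! k) ((q @ [y]) ! j))) \<longleftrightarrow>
        (\<forall>j<length q. 0 < j \<longrightarrow> \<not> (\<forall>k<j. lt (q ! k) (q ! j)))"
    by (simp add: nth_append)
  moreover have "(\<forall>k<length q. lt ((q @ [y]) ! k) y) \<longleftrightarrow> (\<forall>z\<in>set q. lt z y)"
    by (simp add: nth_append all_set_conv_all_nth)
  ultimately show ?thesis unfolding record_free_single by (auto simp: All_less_Suc)
qed

lemma card_mult_chain_record_free: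
  fixes lt :: "'a::linorder \<Rightarrow> 'a \<Rightarrow> bool"
  assumes less: "\<And>x y. lt x y \<Longrightarrow> x < y" and trans: "transp lt" and fin: "finite B"
  shows "real (card B) * of_bool (chain_on lt B) =
    (\<Sum>C | C \<subseteq> B \<and> C \<noteq> {}. (-1) ^ (card C - 1) *
       (\<Sum>r\<in>permutations_of_set C. of_bool (record_free lt [r] \<and> row_semistrict lt [r])) * of_bool (chain_on lt (B - C)))"
proof -
  \<comment> \<open>A sign-reversing involution on pairs of a row \<open>r\<close> and a complementary chain. The elements of
     \<open>L r\<close> are those of the chain that do not become records when appended to \<open>r\<close>; the involution
     moves either the last entry of \<open>r\<close> into the chain or the top of \<open>L r\<close> to the end of \<open>r\<close>.\<close>
  define L where "L = (\<lambda>r. {x \<in> B - set r. \<not> (\<forall>z\<in>set r. lt z x)})"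
  \<comment> \<open>For a \<open>short\<close> row the last entry lies above all of
    \<open>L r\<close>, so that it becomes the top there when moved into the chain. The negation
    contains just the test for appending the top of \<open>L r\<close> while remaining
    semistrict.\<close>
  define short where "short = (\<lambda>r. L r = {} \<or> lt (Max (L r)) (last r))"
  define \<phi> where "\<phi> = (\<lambda>r. if short r then butlast r else r @ [Max (L r)])"
  let ?R = "{r. distinct r \<and> set r \<subseteq> B \<and> set r \<noteq> {}}"
  define good where "good = (\<lambda>r. record_free lt [r] \<and> row_semistrict lt [r] \<and> chain_on lt (B - set r))"
  let ?G = "{r \<in> ?R. good r}"
  \<comment> \<open>These rows have no partner: giving up their only entry would leave the empty
    row.\<close>
  let ?F = "{r \<in> ?G. short r \<and> length r = 1}"
  have finL: "finite (L r)" for r using fin by (simp add: L_def)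
  have finR: "finite ?R" by (rule finite_subset[OF _ finite_subset_distinct[OF fin]]) auto
  have short_step: "butlast r \<in> ?G - ?F \<and> \<not> short (butlast r) \<and> butlast r @ [Max (L (butlast r))] = r"
    if r: "r \<in> ?G - ?F" "short r" for r
  proof -
    have "length r \<noteq> 1" "r \<noteq> []" using r by auto
    then obtain q y where qy: "r = q @ [y]" "q \<noteq> []" by (cases r rule: rev_cases) auto
    have y: "y \<in> B" "y \<notin> set q" using r qy by auto
    have y_rf: "\<not> (\<forall>z\<in>set q. lt z y)" and y_ss: "\<not> lt y (last q)"
      using r qy by (auto simp: good_def record_free_snoc row_semistrict_snoc)
    have below: "lt x y" if "x \<in> L r" for x
    proof -
      have M: "Max (L r) \<in> L r" "lt (Max (L r)) y" using that r(2) finL Max_in by (auto simp: short_def qy)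
      show ?thesis
      proof (cases "x = Max (L r)")
        case False
        then have "x < Max (L r)" using that finL by (simp add: order.not_eq_order_implies_strict)
        moreover have "chain_on lt (B - set r)" using r by (simp add: good_def)
        ultimately have "lt x (Max (L r))" using that M by (auto simp: chain_on_def L_def)
        then show ?thesis using M trans by (auto dest: transpD)
      qed (use M in simp)
    qed
    \<comment> \<open>Putting \<open>y\<close> back yields a chain: the elements of
      \<open>L r\<close> lie below \<open>y\<close>, and the other elements of the chain lie above
      every entry of \<open>r\<close>, among them \<open>y\<close>.\<close>
    have "chain_on lt (B - set q)"
      unfolding chain_on_def
    proof (intro ballI impI)
      fix u v assume uv: "u \<in> B - set q" "v \<in> B - set q" "u < v"
      have ch: "chain_on lt (B - set r)" using r by (simp add: good_def)
      consider "u \<noteq> y" "v \<noteq> y" | "u = y" "v \<noteq> y" | "v = y" "u \<noteq> y" using uv by auto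
      then show "lt u v"
      proof cases
        case 1
        then show ?thesis using ch uv by (auto simp: chain_on_def qy)
      next
        case 2
        then have "v \<notin> L r" using below[of v] less[of v y] uv by auto
        then show ?thesis using uv 2 by (auto simp: L_def qy)
      next
        case 3
        then have "u \<in> L r" using less[of y u] uv by (auto simp: L_def qy)
        then show ?thesis using below 3 by simp
      qed
    qed
    then have G: "q \<in> ?G" using r qy by (auto simp: good_def record_free_snoc row_semistrict_snoc)
    \<comment> \<open>Since \<open>y\<close> was no record of \<open>r\<close>, it belongs to
      \<open>L q\<close>. Any other element of \<open>L q\<close> is in \<open>L r\<close> and thus
      below \<open>y\<close>, so the inverse step will pick \<open>y\<close> again.\<close>
    have "y \<in> L q" using y y_rf by (simp add: L_def)
    moreover have "x \<le> y" if "x \<in> L q" for x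
    proof (cases "x = y")
      case False
      then have "x \<in> L r" using that by (auto simp: L_def qy)
      then show ?thesis using below less by (simp add: less_imp_le)
    qed simp
    ultimately have Max: "Max (L q) = y" using finL by (intro Max_eqI)
    moreover have "\<not> short q" using Max y_ss \<open>y \<in> L q\<close> by (auto simp: short_def)
    ultimately show ?thesis using G qy by auto
  qed
  have long_step: "r @ [Max (L r)] \<in> ?G - ?F \<and> short (r @ [Max (L r)])"
    if r: "r \<in> ?G - ?F" "\<not> short r" for r
  proof -
    define x where "x = Max (L r)"
    have x: "x \<in> L r" "\<not> lt x (last r)" using r(2) finL Max_in by (auto simp: short_def x_def)
    have ch: "chain_on lt (B - set r)" using r by (simp add: good_def)
    have G: "r @ [x] \<in> ?G" using r x ch
      by (auto simp: good_def record_free_snoc row_semistrict_snoc L_def chain_on_def)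
    \<comment> \<open>Either \<open>u\<close> already failed to be a record after \<open>r\<close>,
      and then it is below the maximum \<open>x\<close> of \<open>L r\<close>; or it fails only
      because of \<open>x\<close>, and then it is below \<open>x\<close> in the chain.\<close>
    have "lt u x" if "u \<in> L (r @ [x])" for u
    proof -
      have u: "u \<in> B - set r" "u \<noteq> x" using that by (auto simp: L_def)
      have "u < x"
      proof (cases "u \<in> L r")
        case True
        then show ?thesis using u finL by (simp add: x_def order.not_eq_order_implies_strict)
      next
        case False
        then have "\<not> lt x u" using that by (auto simp: L_def)
        then have "\<not> x < u" using ch u x by (auto simp: chain_on_def L_def)
        then show ?thesis using u by auto
      qed
      then show ?thesis using ch u x by (auto simp: chain_on_def L_def)
    qed
    then have "short (r @ [x])" using finL Max_in by (auto simp: short_def)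
    then show ?thesis using G r by (auto simp: x_def)
  qed
  \<comment> \<open>For a row \<open>[v]\<close> without partner, every other element is comparable
    with \<open>v\<close>: those in \<open>L [v]\<close> lie below it, the rest above. So such a row
    forces \<open>B\<close> to be a chain, and in a chain each of the \<open>card B\<close> elements
    gives one.\<close>
  have single: "good [v] \<and> short [v] \<longleftrightarrow> chain_on lt B" if v: "v \<in> B" for v
  proof
    assume h: "good [v] \<and> short [v]"
    then have ch: "chain_on lt (B - {v})" and sh: "short [v]" by (auto simp: good_def)
    have cmp: "lt v x \<or> lt x v" if x: "x \<in> B - {v}" for x
    proof (cases "x \<in> L [v]")
      case True
      then have M: "Max (L [v]) \<in> L [v]" "lt (Max (L [v])) v" using sh finL Max_in by (auto simp: short_def)
      show ?thesis
      proof (cases "x = Max (L [v])")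
        case False
        then have "x < Max (L [v])" using True finL by (simp add: order.not_eq_order_implies_strict)
        then have "lt x (Max (L [v]))" using True M ch by (auto simp: chain_on_def L_def)
        then show ?thesis using M trans by (auto dest: transpD)
      qed (use M in simp)
    qed (use x in \<open>auto simp: L_def\<close>)
    show "chain_on lt B"
      unfolding chain_on_def
    proof (intro ballI impI)
      fix x y assume xy: "x \<in> B" "y \<in> B" "x < y"
      consider "x \<noteq> v" "y \<noteq> v" | "x = v" "y \<noteq> v" | "y = v" "x \<noteq> v" using xy by auto
      then show "lt x y"
      proof cases
        case 1
        then show ?thesis using ch xy by (auto simp: chain_on_def)
      next
        case 2
        then show ?thesis using cmp[of y] less[of y x] xy by auto
      next
        case 3
        then show ?thesis using cmp[of x] less[of y x] xy by auto
      qed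
    qed
  next
    assume ch: "chain_on lt B"
    have "lt x v" if "x \<in> L [v]" for x
    proof -
      have x: "x \<in> B" "x \<noteq> v" "\<not> lt v x" using that by (auto simp: L_def)
      then have "\<not> v < x" using ch v by (auto simp: chain_on_def)
      then show ?thesis using ch v x by (auto simp: chain_on_def)
    qed
    then have "short [v]" using finL Max_in by (auto simp: short_def)
    moreover have "good [v]" using ch by (auto simp: good_def chain_on_def record_free_def row_semistrict_def)
    ultimately show "good [v] \<and> short [v]" by simp
  qed
  have sumF: "(\<Sum>r\<in>?F. (-1) ^ (length r - 1)) = real (card B) * of_bool (chain_on lt B)"
  proof -
    have "?F = (if chain_on lt B then (\<lambda>v. [v]) ` B else {})"
      using single by (auto simp: length_Suc_conv)
    moreover have "inj_on (\<lambda>v. [v]) B" by (simp add: inj_on_def)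
    ultimately show ?thesis by (simp add: sum.reindex)
  qed
  have inv: "\<phi> (\<phi> r) = r \<and> \<phi> r \<in> ?G - ?F \<and> (-1) ^ (length (\<phi> r) - 1) = - ((-1::real) ^ (length r - 1))"
    if r: "r \<in> ?G - ?F" for r
  proof (cases "short r")
    case True
    have "length r \<noteq> 1" "r \<noteq> []" using r True by auto
    then obtain k where "length r = Suc (Suc k)" by (metis One_nat_def length_0_conv not0_implies_Suc)
    then show ?thesis using short_step[OF r True] True by (auto simp: \<phi>_def)
  next
    case False
    have "r \<noteq> []" using r by auto
    then obtain k where "length r = Suc k" by (cases r) auto
    then show ?thesis using long_step[OF r False] False by (auto simp: \<phi>_def)
  qed
  have "(\<Sum>r\<in>?G - ?F. (-1::real) ^ (length r - 1)) = (\<Sum>r\<in>?G - ?F. - ((-1) ^ (length r - 1)))"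
    by (rule sum.reindex_bij_witness[of _ \<phi> \<phi>]) (use inv in auto)
  then have zero: "(\<Sum>r\<in>?G - ?F. (-1::real) ^ (length r - 1)) = 0"
    by (simp add: sum_negf)
  have "(\<Sum>C | C \<subseteq> B \<and> C \<noteq> {}. (-1) ^ (card C - 1) *
       (\<Sum>r\<in>permutations_of_set C. of_bool (record_free lt [r] \<and> row_semistrict lt [r])) * of_bool (chain_on lt (B - C)))
     = (\<Sum>C | C \<subseteq> B \<and> C \<noteq> {}. \<Sum>r\<in>permutations_of_set C. (-1::real) ^ (length r - 1) * of_bool (good r))"
    by (intro sum.cong refl)
      (auto simp: sum_distrib_left sum_distrib_right permutations_of_set_def good_def distinct_card intro!: sum.cong)
  also have "\<dots> = (\<Sum>r\<in>?R. (-1) ^ (length r - 1) * of_bool (good r))"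
    by (rule sum_group_orderings[OF fin, where Q = "\<lambda>C. C \<noteq> {}", symmetric])
  also have "\<dots> = (\<Sum>r\<in>?G. (-1) ^ (length r - 1))"
    unfolding sum.inter_filter[OF finR] by (intro sum.cong) auto
  also have "\<dots> = (\<Sum>r\<in>?G - ?F. (-1) ^ (length r - 1)) + (\<Sum>r\<in>?F. (-1) ^ (length r - 1))"
    by (intro sum.subset_diff finite_subset[OF _ finR]) auto
  finally show ?thesis using zero sumF by simp
qed

section \<open>Paths in planar networks\<close>

lemma cis_inj_lt_2pi:
  assumes "cis a = cis b" "a - b < 2 * pi" "b - a < 2 * pi"
  shows "a = b"
proof -
  have "sin a = sin b \<and> cos a = cos b" using assms(1) by (simp add: complex_eq_iff)
  then obtain k where k: "a = b + 2 * pi * k" "k \<in> \<int>" by (auto simp: sin_cos_eq_iff)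
  then have "2 * pi * k < 2 * pi * 1" "2 * pi * (-1) < 2 * pi * k" using assms(2,3) by auto
  then have "k < 1" "-1 < k" by (simp_all only: mult_less_cancel_left_pos[of "2 * pi"] pi_gt_zero zero_less_mult_iff zero_less_numeral simp_thms)
  with k(2) have "k = 0" by (auto elim!: Ints_cases)
  with k(1) show ?thesis by simp
qed

lemma clockwise_on_circle_distinct:
  assumes "clockwise_on_circle zs"
  shows "distinct zs"
proof -
  obtain \<theta>s where \<theta>s: "zs = map cis \<theta>s" "sorted_wrt (>) \<theta>s" "\<forall>a\<in>set \<theta>s. \<forall>b\<in>set \<theta>s. a - b < 2 * pi"
    using assms unfolding clockwise_on_circle_def by blast
  have "inj_on cis (set \<theta>s)" using \<theta>s(3) by (intro inj_onI cis_inj_lt_2pi) auto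
  moreover have "distinct \<theta>s" using \<theta>s(2) by (auto simp: distinct_conv_nth sorted_wrt_iff_nth_less) (metis less_irrefl linorder_neqE_nat)
  ultimately show ?thesis by (simp add: \<theta>s(1) distinct_map)
qed

section \<open>Walks in an acyclic network, cut at a vertex\<close>

context planar_network begin

text \<open>A repeated vertex would give a closed walk. Thus walks are paths, and pieces of
  different paths can be joined without checking for repetitions.\<close>

lemma awalk_imp_distinct_verts:
  assumes "awalk u p v"
  shows "distinct (awalk_verts u p)"
proof (rule ccontr)
  assume "\<not> distinct (awalk_verts u p)"
  then obtain r w where "r \<noteq> []" "awalk w r w"
    using awalk_not_distinct_decomp[OF assms] by auto
  then have "(w, w) \<in> (arcs_ends D)\<^sup>+" by (rule reachable1_awalkI[rotated])
  then show False using acyclic by (simp add: acyclic_def)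
qed

lemma paths_between_iff: "p \<in> paths_between D u v \<longleftrightarrow> awalk u p v"
  by (auto simp: paths_between_def apath_def intro: awalk_imp_distinct_verts)

lemma finite_paths_between: "finite (paths_between D u v)"
  unfolding paths_between_def by (rule apaths_finite)

lemma no_mutual_reach:
  assumes "awalk u p v" "awalk v q u"
  shows "u = v"
proof (rule ccontr)
  assume "u \<noteq> v"
  then have "p @ q \<noteq> []" using assms by (auto simp: awalk_Nil_iff)
  moreover have "awalk u (p @ q) u" using assms by (rule awalk_appendI)
  ultimately have "(u, u) \<in> (arcs_ends D)\<^sup>+" by (metis reachable1_awalkI)
  then show False using acyclic by (simp add: acyclic_def)
qed

text \<open>The cut is made at the first arc leaving \<open>v\<close>. If \<open>v\<close> is the
  end of the path, no arc leaves it and the whole path comes before \<open>v\<close>.\<close>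

definition before :: "'a \<Rightarrow> 'b list \<Rightarrow> 'b list" where
  "before v p = takeWhile (\<lambda>e. tail D e \<noteq> v) p"

definition after :: "'a \<Rightarrow> 'b list \<Rightarrow> 'b list" where
  "after v p = dropWhile (\<lambda>e. tail D e \<noteq> v) p"

lemma before_after [simp]: "before v p @ after v p = p"
  by (simp add: before_def after_def)

text \<open>The vertices of a walk are distinct, so no arc of \<open>q\<close> leaves its end
  \<open>v\<close>. A path glued at \<open>v\<close> can therefore be cut again into the same
  pieces, which is why exchanging tails twice restores a family.\<close>

lemma before_after_append:
  assumes "awalk u q v" "awalk v r w"
  shows "before v (q @ r) = q" "after v (q @ r) = r"
proof -
  have q: "tail D e \<noteq> v" if e: "e \<in> set q" for e
  proof -
    have ne: "q \<noteq> []" using e by auto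
    have "distinct (map (tail D) q @ [head D (last q)])"
      using awalk_imp_distinct_verts[OF assms(1)] ne by (simp add: awalk_verts_conv)
    moreover have "head D (last q) = v"
      using awlast_of_awalk[OF assms(1)] ne assms(1) by (auto simp: awalk_verts_conv)
    ultimately show ?thesis using e by (auto simp: image_iff)
  qed
  have r: "r = [] \<or> (\<exists>e r'. r = e # r' \<and> tail D e = v)"
    using assms(2) by (cases r) (auto simp: awalk_Cons_iff)
  show "before v (q @ r) = q" "after v (q @ r) = r"
    using q r unfolding before_def after_def by (auto simp: takeWhile_append2 dropWhile_append2)
qed

lemma awalk_before_after:
  assumes "awalk u p w" "v \<in> set (awalk_verts u p)"
  shows "awalk u (before v p) v" "awalk v (after v p) w"
proof -
  obtain q r where "p = q @ r" "awalk u q v" "awalk v r w"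
    using awalk_decomp[OF assms] by blast
  then show "awalk u (before v p) v" "awalk v (after v p) w"
    using before_after_append by auto
qed

lemma set_awalk_verts_before_after:
  assumes "awalk u p w" "v \<in> set (awalk_verts u p)"
  shows "set (awalk_verts u p) = set (awalk_verts u (before v p)) \<union> set (awalk_verts v (after v p))"
  using set_awalk_verts_append[OF awalk_before_after[OF assms]] by simp

lemma end_in_awalk_verts: "awalk u p v \<Longrightarrow> v \<in> set (awalk_verts u p)"
  by (metis awalk_verts_non_Nil awlast_of_awalk last_in_set awalkE')

text \<open>Otherwise \<open>x\<close> and \<open>v\<close> would reach each other. This keeps a
  tail exchange from losing a shared vertex: apart from \<open>v\<close>, none can precede
  \<open>v\<close> on one path and follow it on the other.\<close>

lemma before_after_inter:
  assumes "awalk u q v" "awalk v r w" "x \<in> set (awalk_verts u q)" "x \<in> set (awalk_verts v r)"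
  shows "x = v"
proof -
  obtain a where "awalk x a v" using awalk_decomp[OF assms(1,3)] by blast
  moreover obtain b where "awalk v b x" using awalk_decomp[OF assms(2,4)] by blast
  ultimately show ?thesis by (rule no_mutual_reach)
qed

lemma path_weight_append: "path_weight wt (p @ q) = path_weight wt p * path_weight wt q"
  by (simp add: path_weight_def)

text \<open>The curves of the arcs are joined. The start is listed separately for the walk without
  arcs, which is drawn as a single point.\<close>

lemma path_along_awalk:
  assumes "awalk u p v" "disc_embedding D pos crv"
  shows "\<exists>\<gamma>. Path_Connected.path \<gamma> \<and> pathstart \<gamma> = pos u \<and> pathfinish \<gamma> = pos v \<and>
    path_image \<gamma> \<subseteq> insert (pos u) (\<Union>e\<in>set p. path_image (crv e))"
  using assms(1)
proof (induction p arbitrary: u)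
  case Nil
  then have "u = v" by (simp add: awalk_Nil_iff)
  show ?case
  proof (intro exI conjI)
    show "Path_Connected.path (linepath (pos u) (pos v))" by (rule path_linepath)
    show "path_image (linepath (pos u) (pos v)) \<subseteq> insert (pos u) (\<Union>e\<in>set []. path_image (crv e))"
      using \<open>u = v\<close> by simp
  qed (rule pathstart_linepath pathfinish_linepath)+
next
  case (Cons e p)
  then have e: "e \<in> arcs D" "u = tail D e" "awalk (head D e) p v" by (auto simp: awalk_Cons_iff)
  obtain \<gamma> where \<gamma>: "Path_Connected.path \<gamma>" "pathstart \<gamma> = pos (head D e)" "pathfinish \<gamma> = pos v"
    "path_image \<gamma> \<subseteq> insert (pos (head D e)) (\<Union>e\<in>set p. path_image (crv e))"
    using Cons.IH[OF e(3)] by blast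
  have crv: "Path_Connected.path (crv e)" "pathstart (crv e) = pos (tail D e)" "pathfinish (crv e) = pos (head D e)"
    using assms(2) e(1) by (auto simp: disc_embedding_def arc_imp_path)
  have "pos (head D e) \<in> path_image (crv e)" using crv(3) by (metis pathfinish_in_path_image)
  then have "path_image (crv e +++ \<gamma>) \<subseteq> insert (pos u) (\<Union>e\<in>set (e # p). path_image (crv e))"
    using \<gamma>(2,4) crv(3) by (auto simp: path_image_join)
  then show ?case using \<gamma> crv e(2) by (intro exI[of _ "crv e +++ \<gamma>"]) simp
qed

lemma distinct_terminals: "distinct (map s [1..<Suc n] @ rev (map t [1..<Suc n]))"
proof -
  obtain pos crv where "clockwise_on_circle (map pos (map s [1..<Suc n] @ rev (map t [1..<Suc n])))"
    using planar by blast
  from clockwise_on_circle_distinct[OF this] show ?thesis unfolding distinct_map by blast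
qed

lemma inj_on_s: "inj_on s {1..n}" and inj_on_t: "inj_on t {1..n}"
  and s_neq_t: "i \<in> {1..n} \<Longrightarrow> j \<in> {1..n} \<Longrightarrow> s i \<noteq> t j"
proof -
  show "inj_on s {1..n}" "inj_on t {1..n}"
    using distinct_terminals by (auto simp: distinct_map atLeastLessThanSuc_atLeastAtMost simp del: upt_Suc)
  have "s ` {1..n} \<inter> t ` {1..n} = {}"
    using distinct_terminals by (simp add: atLeastLessThanSuc_atLeastAtMost del: upt_Suc)
  then show "s i \<noteq> t j" if "i \<in> {1..n}" "j \<in> {1..n}" using that by blast
qed

text \<open>In clockwise order the end points are \<open>s i\<close>, \<open>s k\<close>,
  \<open>t j\<close>, \<open>t m\<close>, so the drawn curves meet. A meeting point is either a
  vertex, which then lies on both walks, or an inner point of the curve of a unique arc, which then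
  belongs to both walks.\<close>

lemma crossing_paths_meet:
  assumes ix: "i \<in> {1..n}" "k \<in> {1..n}" "j \<in> {1..n}" "m \<in> {1..n}" "i < k" "m < j"
    and p: "awalk (s i) p (t j)" and q: "awalk (s k) q (t m)"
  shows "set (awalk_verts (s i) p) \<inter> set (awalk_verts (s k) q) \<noteq> {}"
proof -
  let ?ends = "map s [1..<Suc n] @ rev (map t [1..<Suc n])"
  obtain pos crv where emb: "disc_embedding D pos crv" and "clockwise_on_circle (map pos ?ends)"
    using planar by blast
  then obtain \<theta>s where \<theta>s: "map pos ?ends = map cis \<theta>s" "sorted_wrt (>) \<theta>s"
    "\<forall>a\<in>set \<theta>s. \<forall>b\<in>set \<theta>s. a - b < 2 * pi"
    unfolding clockwise_on_circle_def by blast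
  have len: "length \<theta>s = 2 * n" using arg_cong[OF \<theta>s(1), of length] by (simp del: upt_Suc)
  have nth: "pos (?ends ! l) = cis (\<theta>s ! l)" if "l < 2 * n" for l
    using arg_cong[OF \<theta>s(1), of "\<lambda>xs. xs ! l"] that len by (simp del: upt_Suc map_append)
  have s_at: "pos (s l) = cis (\<theta>s ! (l - 1))" if "l \<in> {1..n}" for l
    using nth[of "l - 1"] that by (cases l) (simp_all add: nth_append del: upt_Suc)
  \<comment> \<open>The sinks follow the \<open>n\<close> sources in reverse, so \<open>t l\<close>
    stands at position \<open>2 * n - l\<close>, counted from \<open>0\<close>.\<close>
  have t_at: "pos (t l) = cis (\<theta>s ! (2 * n - l))" if "l \<in> {1..n}" for l
  proof -
    have "?ends ! (2 * n - l) = ?ends ! (length (map s [1..<Suc n]) + (n - l))"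
      using that by (intro arg_cong2[where f = "(!)"]) (auto simp del: upt_Suc)
    also have "\<dots> = rev (map t [1..<Suc n]) ! (n - l)" by (rule nth_append_length_plus)
    also have "\<dots> = map t [1..<Suc n] ! (length (map t [1..<Suc n]) - Suc (n - l))"
      using that by (intro rev_nth) (auto simp del: upt_Suc)
    also have "length (map t [1..<Suc n]) - Suc (n - l) = l - 1"
      using that by (simp del: upt_Suc)
    also have "map t [1..<Suc n] ! (l - 1) = t l"
      using that by (cases l) (simp_all del: upt_Suc)
    finally show ?thesis using nth[of "2 * n - l"] that by (simp del: upt_Suc)
  qed
  have decr: "\<theta>s ! b < \<theta>s ! a" if "a < b" "b < 2 * n" for a b
    using \<theta>s(2) that len by (simp add: sorted_wrt_iff_nth_less)
  obtain f where f: "Path_Connected.path f" "pathstart f = pos (s i)" "pathfinish f = pos (t j)"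
    "path_image f \<subseteq> insert (pos (s i)) (\<Union>e\<in>set p. path_image (crv e))"
    using path_along_awalk[OF p emb] by blast
  obtain g where g: "Path_Connected.path g" "pathstart g = pos (s k)" "pathfinish g = pos (t m)"
    "path_image g \<subseteq> insert (pos (s k)) (\<Union>e\<in>set q. path_image (crv e))"
    using path_along_awalk[OF q emb] by blast
  have arcs: "set p \<subseteq> arcs D" "set q \<subseteq> arcs D" using p q by auto
  have disc: "pos ` verts D \<subseteq> cball 0 1" "\<And>e. e \<in> arcs D \<Longrightarrow> path_image (crv e) \<subseteq> cball 0 1"
    using emb by (auto simp: disc_embedding_def)
  have "path_image f \<inter> path_image g \<noteq> {}"
  proof (rule disc_chords_meet[OF f(1) g(1)])
    show "path_image f \<subseteq> cball 0 1" "path_image g \<subseteq> cball 0 1"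
      using f(4) g(4) disc arcs source_in_verts ix by blast+
    show "pathstart f = cis (\<theta>s ! (i - 1))" "pathstart g = cis (\<theta>s ! (k - 1))"
      "pathfinish f = cis (\<theta>s ! (2 * n - j))" "pathfinish g = cis (\<theta>s ! (2 * n - m))"
      using f g s_at t_at ix by auto
    show "\<theta>s ! (k - 1) < \<theta>s ! (i - 1)" "\<theta>s ! (2 * n - j) < \<theta>s ! (k - 1)"
      "\<theta>s ! (2 * n - m) < \<theta>s ! (2 * n - j)"
      using ix by (auto intro!: decr)
    show "\<theta>s ! (i - 1) - \<theta>s ! (2 * n - m) < 2 * pi"
      using \<theta>s(3) len ix by auto
  qed
  then obtain z where z: "z \<in> path_image f" "z \<in> path_image g" by blast
  \<comment> \<open>The curve of an arc contains no vertex other than its ends, so a vertex met by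
    the drawing of a walk is visited by the walk.\<close>
  have at_vertex: "x \<in> set (awalk_verts u p)"
    if w: "awalk u p v" "pos x \<in> insert (pos u) (\<Union>e\<in>set p. path_image (crv e))" "x \<in> verts D" for u p v x
  proof -
    have inj: "inj_on pos (verts D)" using emb by (simp add: disc_embedding_def)
    have u: "u \<in> verts D" and p: "set p \<subseteq> arcs D" using w(1) by (auto simp: awalk_def)
    show ?thesis
    proof (cases "pos x = pos u")
      case True
      then have "x = u" using inj u w(3) by (auto dest: inj_onD)
      then show ?thesis using w(1) by (auto intro: hd_in_awalk_verts)
    next
      case False
      then obtain e where e: "e \<in> set p" "pos x \<in> path_image (crv e)" using w(2) by auto
      then have "e \<in> arcs D" using p by auto
      then have "pos x \<in> {pos (tail D e), pos (head D e)}"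
        using emb e w(3) unfolding disc_embedding_def by blast
      then have "x = tail D e \<or> x = head D e"
        using inj w(3) \<open>e \<in> arcs D\<close> by (auto dest: inj_onD)
      then show ?thesis using e(1) w(1) by (auto simp: set_awalk_verts)
    qed
  qed
  show ?thesis
  proof (cases "z \<in> pos ` verts D")
    case True
    then obtain x where "x \<in> verts D" "z = pos x" by auto
    then show ?thesis using z f(4) g(4) at_vertex[OF p, of x] at_vertex[OF q, of x] by blast
  next
    case False
    have "s i \<in> verts D" "s k \<in> verts D" using ix source_in_verts by auto
    then obtain e e' where e: "e \<in> set p" "z \<in> path_image (crv e)" "e' \<in> set q" "z \<in> path_image (crv e')"
      using False z f(4) g(4) by blast
    have "e = e'"
    proof (rule ccontr)
      assume "e \<noteq> e'"
      then have "path_image (crv e) \<inter> path_image (crv e') \<subseteq> pos ` verts D"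
      proof -
        have "e \<in> arcs D" "e' \<in> arcs D" using e arcs by auto
        then show ?thesis using emb \<open>e \<noteq> e'\<close> by (simp add: disc_embedding_def)
      qed
      then show False using e False by blast
    qed
    then show ?thesis using e(1,3) awalk_verts_arc1[of e p] awalk_verts_arc1[of e q] by auto
  qed
qed

end

section \<open>The Lindstroem-Gessel-Viennot lemma\<close>

definition shared :: "'i set \<Rightarrow> ('i \<Rightarrow> 'v set) \<Rightarrow> 'v set" where
  "shared B V = {v. \<exists>i\<in>B. \<exists>j\<in>B. i \<noteq> j \<and> v \<in> V i \<and> v \<in> V j}"

lemma sharedI: "i \<in> B \<Longrightarrow> j \<in> B \<Longrightarrow> i \<noteq> j \<Longrightarrow> v \<in> V i \<Longrightarrow> v \<in> V j \<Longrightarrow> v \<in> shared B V"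
  unfolding shared_def by blast

text \<open>The condition on the unions covers vertices shared by one of the two changed paths and a
  third one, the condition on the intersections those shared by the two themselves.\<close>

lemma shared_mono_swap:
  assumes "i \<in> B" "j \<in> B" "i \<noteq> j" "V i \<union> V j = V' i \<union> V' j" "V i \<inter> V j \<subseteq> V' i \<inter> V' j"
    and "\<And>k. k \<in> B \<Longrightarrow> k \<noteq> i \<Longrightarrow> k \<noteq> j \<Longrightarrow> V' k = V k"
  shows "shared B V \<subseteq> shared B V'"
proof
  fix v assume "v \<in> shared B V"
  then obtain k l where kl: "k \<in> B" "l \<in> B" "k \<noteq> l" "v \<in> V k" "v \<in> V l" by (auto simp: shared_def)
  have one: "\<exists>m\<in>{i, j}. v \<in> V' m" if "v \<in> V i \<or> v \<in> V j" using that assms(4) by auto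
  consider "k \<notin> {i, j}" "l \<notin> {i, j}" | "k \<in> {i, j}" "l \<notin> {i, j}" | "k \<notin> {i, j}" "l \<in> {i, j}" | "{k, l} = {i, j}"
    using kl(3) by auto
  then show "v \<in> shared B V'"
  proof cases
    case 1
    then show ?thesis using kl assms(6) unfolding shared_def by blast
  next
    case 2
    then obtain m where "m \<in> {i, j}" "v \<in> V' m" using one kl by auto
    moreover have "v \<in> V' l" using 2 kl assms(6)[of l] by auto
    ultimately show ?thesis using 2 kl assms(1,2) unfolding shared_def by blast
  next
    case 3
    then obtain m where "m \<in> {i, j}" "v \<in> V' m" using one kl by auto
    moreover have "v \<in> V' k" using 3 kl assms(6)[of k] by auto
    ultimately show ?thesis using 3 kl assms(1,2) unfolding shared_def by blast
  next
    case 4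
    then have "v \<in> V i \<inter> V j" using kl by (auto simp: doubleton_eq_iff)
    then show ?thesis using assms(1-3,5) unfolding shared_def by blast
  qed
qed

text \<open>The least moved point \<open>x\<close> can only be moved up, and the point sent to
  \<open>x\<close> lies to its right; the two form an inversion.\<close>

lemma inversion_of_nonid_permutation:
  fixes w :: "'a::linorder \<Rightarrow> 'a"
  assumes "w permutes B" "finite B" "w \<noteq> id"
  obtains i k where "i \<in> B" "k \<in> B" "i < k" "w k < w i"
proof -
  let ?S = "{x \<in> B. w x \<noteq> x}"
  have "?S \<noteq> {}" using assms by (auto simp: fun_eq_iff permutes_def)
  define x where "x = Min ?S"
  have x: "x \<in> B" "w x \<noteq> x" and least: "y \<in> B \<Longrightarrow> w y \<noteq> y \<Longrightarrow> x \<le> y" for y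
    using Min_in[of ?S] Min_le[of ?S] assms(2) \<open>?S \<noteq> {}\<close> by (auto simp: x_def)
  have inj: "inj w" using assms(1) permutes_inj by blast
  have "x < w x"
  proof (rule ccontr)
    assume "\<not> x < w x"
    then have "w x < x" using x by simp
    moreover have "w x \<in> B" using x assms(1) by (simp add: permutes_in_image)
    ultimately have "w (w x) = w x" using least[of "w x"] by (meson leD)
    then show False using inj x by (auto dest: injD)
  qed
  have "x \<in> w ` B" using x permutes_image[OF assms(1)] by simp
  then obtain y where y: "y \<in> B" "w y = x" by auto
  then have "y \<noteq> x" using x by auto
  then have "x < y" using least[of y] y by auto
  then show thesis using that[of x y] x y \<open>x < w x\<close> by auto
qed

context planar_network begin

abbreviation path_verts :: "(nat \<Rightarrow> 'b list) \<Rightarrow> nat \<Rightarrow> 'a set" where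
  "path_verts \<pi> i \<equiv> set (awalk_verts (s i) (\<pi> i))"

definition families_of_type :: "nat set \<Rightarrow> (nat \<Rightarrow> nat) \<Rightarrow> (nat \<Rightarrow> 'b list) set" where
  "families_of_type B w = PiE B (\<lambda>i. paths_between D (s i) (t (w i)))"

definition weight_on :: "nat set \<Rightarrow> (nat \<Rightarrow> 'b list) \<Rightarrow> real" where
  "weight_on B \<pi> = (\<Prod>i\<in>B. path_weight wt (\<pi> i))"

definition swap_tails :: "nat \<Rightarrow> nat \<Rightarrow> 'a \<Rightarrow> (nat \<Rightarrow> 'b list) \<Rightarrow> nat \<Rightarrow> 'b list" where
  "swap_tails i j v \<pi> = \<pi>(i := before v (\<pi> i) @ after v (\<pi> j), j := before v (\<pi> j) @ after v (\<pi> i))"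

lemma finite_families_of_type: "finite B \<Longrightarrow> finite (families_of_type B w)"
  unfolding families_of_type_def by (intro finite_PiE finite_paths_between)

lemma awalk_family:
  "\<pi> \<in> families_of_type B w \<Longrightarrow> i \<in> B \<Longrightarrow> awalk (s i) (\<pi> i) (t (w i))"
  by (auto simp: families_of_type_def paths_between_iff dest: PiE_mem)

text \<open>Everything that the sign-reversing involution reads off is kept: the vertex
  \<open>v\<close> stays on both paths, their union of vertices is unchanged, and no common vertex
  is lost. That none is gained follows by exchanging the tails back.\<close>

lemma swap_tails:
  assumes \<pi>: "\<pi> \<in> families_of_type B w" and ij: "i \<in> B" "j \<in> B" "i \<noteq> j"
    and v: "v \<in> path_verts \<pi> i" "v \<in> path_verts \<pi> j"
  shows "swap_tails i j v \<pi> \<in> families_of_type B (w \<circ> Transposition.transpose i j)"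
    and "swap_tails i j v (swap_tails i j v \<pi>) = \<pi>"
    and "v \<in> path_verts (swap_tails i j v \<pi>) i" "v \<in> path_verts (swap_tails i j v \<pi>) j"
    and "path_verts \<pi> i \<union> path_verts \<pi> j = path_verts (swap_tails i j v \<pi>) i \<union> path_verts (swap_tails i j v \<pi>) j"
    and "path_verts \<pi> i \<inter> path_verts \<pi> j \<subseteq> path_verts (swap_tails i j v \<pi>) i \<inter> path_verts (swap_tails i j v \<pi>) j"
    and "finite B \<Longrightarrow> weight_on B (swap_tails i j v \<pi>) = weight_on B \<pi>"
proof -
  let ?p = "swap_tails i j v \<pi>"
  have i: "awalk (s i) (before v (\<pi> i)) v" "awalk v (after v (\<pi> i)) (t (w i))"
    using awalk_before_after[OF awalk_family[OF \<pi> ij(1)] v(1)] .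
  have j: "awalk (s j) (before v (\<pi> j)) v" "awalk v (after v (\<pi> j)) (t (w j))"
    using awalk_before_after[OF awalk_family[OF \<pi> ij(2)] v(2)] .
  have p: "?p i = before v (\<pi> i) @ after v (\<pi> j)" "?p j = before v (\<pi> j) @ after v (\<pi> i)"
    "\<And>k. k \<noteq> i \<Longrightarrow> k \<noteq> j \<Longrightarrow> ?p k = \<pi> k"
    using ij by (auto simp: swap_tails_def)
  have walks: "awalk (s i) (?p i) (t (w j))" "awalk (s j) (?p j) (t (w i))"
    unfolding p(1,2) using i j by (auto intro: awalk_appendI)
  show "?p \<in> families_of_type B (w \<circ> Transposition.transpose i j)"
    unfolding families_of_type_def
  proof (rule PiE_I)
    fix k assume "k \<in> B"
    then show "?p k \<in> paths_between D (s k) (t ((w \<circ> Transposition.transpose i j) k))"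
      using walks awalk_family[OF \<pi>] p(3)[of k]
      by (cases "k = i"; cases "k = j") (auto simp: paths_between_iff)
  next
    fix k assume "k \<notin> B"
    moreover from this have "\<pi> k = undefined" using \<pi> unfolding families_of_type_def by (rule PiE_arb[rotated])
    ultimately show "?p k = undefined" using ij p(3)[of k] by metis
  qed
  have ba: "before v (?p i) = before v (\<pi> i)" "after v (?p i) = after v (\<pi> j)"
    "before v (?p j) = before v (\<pi> j)" "after v (?p j) = after v (\<pi> i)"
    unfolding p(1,2) using before_after_append[OF i(1) j(2)] before_after_append[OF j(1) i(2)] by auto
  show "swap_tails i j v ?p = \<pi>"
  proof
    fix k
    show "swap_tails i j v ?p k = \<pi> k"
      using ba p(3)[of k] ij by (cases "k = i"; cases "k = j") (simp_all add: swap_tails_def[of i j v ?p])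
  qed
  have V: "path_verts \<pi> i = set (awalk_verts (s i) (before v (\<pi> i))) \<union> set (awalk_verts v (after v (\<pi> i)))"
     "path_verts \<pi> j = set (awalk_verts (s j) (before v (\<pi> j))) \<union> set (awalk_verts v (after v (\<pi> j)))"
    by (rule set_awalk_verts_before_after[OF awalk_family[OF \<pi> ij(1)] v(1)],
        rule set_awalk_verts_before_after[OF awalk_family[OF \<pi> ij(2)] v(2)])
  have V': "path_verts ?p i = set (awalk_verts (s i) (before v (\<pi> i))) \<union> set (awalk_verts v (after v (\<pi> j)))"
     "path_verts ?p j = set (awalk_verts (s j) (before v (\<pi> j))) \<union> set (awalk_verts v (after v (\<pi> i)))"
    unfolding p(1,2) by (rule set_awalk_verts_append[OF i(1) j(2)], rule set_awalk_verts_append[OF j(1) i(2)])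
  show vp: "v \<in> path_verts ?p i" "v \<in> path_verts ?p j"
    unfolding V' using end_in_awalk_verts[OF i(1)] end_in_awalk_verts[OF j(1)] by simp_all
  show "path_verts \<pi> i \<union> path_verts \<pi> j = path_verts ?p i \<union> path_verts ?p j"
    unfolding V V' by blast
  show "path_verts \<pi> i \<inter> path_verts \<pi> j \<subseteq> path_verts ?p i \<inter> path_verts ?p j"
  proof
    fix x assume x: "x \<in> path_verts \<pi> i \<inter> path_verts \<pi> j"
    have "x = v" if "x \<in> set (awalk_verts (s i) (before v (\<pi> i)))" "x \<in> set (awalk_verts v (after v (\<pi> j)))"
      using before_after_inter[OF i(1) j(2) that] .
    moreover have "x = v" if "x \<in> set (awalk_verts (s j) (before v (\<pi> j)))" "x \<in> set (awalk_verts v (after v (\<pi> i)))"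
      using before_after_inter[OF j(1) i(2) that] .
    ultimately show "x \<in> path_verts ?p i \<inter> path_verts ?p j"
      using x vp unfolding V V' by blast
  qed
  show "weight_on B ?p = weight_on B \<pi>" if "finite B"
  proof -
    have split: "weight_on B \<rho> = path_weight wt (\<rho> i) * (path_weight wt (\<rho> j) * (\<Prod>k\<in>B - {i} - {j}. path_weight wt (\<rho> k)))" for \<rho>
      unfolding weight_on_def using that ij by (subst prod.remove[of _ i], simp, simp) (subst prod.remove[of _ j], auto)
    have "(\<Prod>k\<in>B - {i} - {j}. path_weight wt (?p k)) = (\<Prod>k\<in>B - {i} - {j}. path_weight wt (\<pi> k))"
      by (intro prod.cong) (auto simp: p(3))
    moreover have "path_weight wt (?p i) * path_weight wt (?p j) = path_weight wt (\<pi> i) * path_weight wt (\<pi> j)"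
    proof -
      have "path_weight wt (\<pi> k) = path_weight wt (before v (\<pi> k)) * path_weight wt (after v (\<pi> k))" for k
        by (simp flip: path_weight_append)
      then show ?thesis by (simp add: p path_weight_append)
    qed
    ultimately show ?thesis unfolding split by (simp flip: mult.assoc)
  qed
qed

lemma det_on_path_matrix:
  assumes B: "B \<subseteq> {1..n}"
  shows "det_on B (path_matrix D wt s t) =
    (\<Sum>\<pi>\<in>families_of_type B id. weight_on B \<pi> * of_bool (shared B (path_verts \<pi>) = {}))"
proof -
  have finB: "finite B" using B finite_subset by blast
  have finP: "finite {w. w permutes B}" using finB by (rule finite_permutations)
  \<comment> \<open>The pivot depends only on the set of shared vertices, and the pair only on the set of paths through
     the pivot. Swapping tails preserves both sets, so the swap is an involution.\<close>
  define pivot where "pivot = (\<lambda>\<pi>. SOME v. v \<in> shared B (path_verts \<pi>))"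
  define pair where "pair = (\<lambda>\<pi>. SOME (i, j). i \<in> {i \<in> B. pivot \<pi> \<in> path_verts \<pi> i} \<and>
     j \<in> {i \<in> B. pivot \<pi> \<in> path_verts \<pi> i} \<and> i \<noteq> j)"
  let ?Z = "SIGMA w:{w. w permutes B}. families_of_type B w"
  let ?bad = "{z \<in> ?Z. shared B (path_verts (snd z)) \<noteq> {}}"
  let ?good = "{z \<in> ?Z. shared B (path_verts (snd z)) = {}}"
  define F where "F = (\<lambda>(w :: nat \<Rightarrow> nat, \<pi>). real_of_int (sign w) * weight_on B \<pi>)"
  define \<phi> where "\<phi> = (\<lambda>(w :: nat \<Rightarrow> nat, \<pi>). case pair \<pi> of (i, j) \<Rightarrow>
     (w \<circ> Transposition.transpose i j, swap_tails i j (pivot \<pi>) \<pi>))"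
  have finZ: "finite ?Z" using finP finite_families_of_type[OF finB] by blast
  have step: "\<phi> z \<in> ?bad \<and> \<phi> (\<phi> z) = z \<and> F (\<phi> z) = - F z" if z: "z \<in> ?bad" for z
  proof -
    obtain w \<pi> where w\<pi>: "z = (w, \<pi>)" by (cases z)
    have w: "w permutes B" and \<pi>: "\<pi> \<in> families_of_type B w" and ne: "shared B (path_verts \<pi>) \<noteq> {}"
      using z w\<pi> by auto
    have "pivot \<pi> \<in> shared B (path_verts \<pi>)" unfolding pivot_def using ne by (simp add: some_in_eq)
    then have ex: "\<exists>p. case p of (i, j) \<Rightarrow> i \<in> {i \<in> B. pivot \<pi> \<in> path_verts \<pi> i} \<and>
       j \<in> {i \<in> B. pivot \<pi> \<in> path_verts \<pi> i} \<and> i \<noteq> j"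
      by (auto simp: shared_def)
    obtain i j where ij: "pair \<pi> = (i, j)" by (cases "pair \<pi>")
    have "case pair \<pi> of (i, j) \<Rightarrow> i \<in> {i \<in> B. pivot \<pi> \<in> path_verts \<pi> i} \<and>
       j \<in> {i \<in> B. pivot \<pi> \<in> path_verts \<pi> i} \<and> i \<noteq> j"
      unfolding pair_def by (rule someI_ex[OF ex])
    then have ijB: "i \<in> B" "j \<in> B" "i \<noteq> j" "pivot \<pi> \<in> path_verts \<pi> i" "pivot \<pi> \<in> path_verts \<pi> j"
      by (auto simp: ij)
    define \<rho> where "\<rho> = swap_tails i j (pivot \<pi>) \<pi>"
    define w' where "w' = w \<circ> Transposition.transpose i j"
    note sw = swap_tails[OF \<pi> ijB, folded \<rho>_def w'_def]
    have \<phi>z: "\<phi> z = (w', \<rho>)" by (simp add: \<phi>_def w\<pi> ij \<rho>_def w'_def)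
    have other: "path_verts \<rho> k = path_verts \<pi> k" if "k \<noteq> i" "k \<noteq> j" for k
      using that by (simp add: \<rho>_def swap_tails_def)
    have "shared B (path_verts \<pi>) \<subseteq> shared B (path_verts \<rho>)"
      by (rule shared_mono_swap[OF ijB(1-3) sw(5,6) other])
    moreover have "shared B (path_verts \<rho>) \<subseteq> shared B (path_verts \<pi>)"
    proof (rule shared_mono_swap[OF ijB(1-3) sw(5)[symmetric]])
      show "path_verts \<rho> i \<inter> path_verts \<rho> j \<subseteq> path_verts \<pi> i \<inter> path_verts \<pi> j"
        using swap_tails(6)[OF sw(1) ijB(1-3) sw(3,4)] sw(2) by simp
    qed (use other in auto)
    ultimately have sh: "shared B (path_verts \<rho>) = shared B (path_verts \<pi>)" by blast
    then have piv: "pivot \<rho> = pivot \<pi>" by (simp add: pivot_def)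
    have "{k \<in> B. pivot \<pi> \<in> path_verts \<rho> k} = {k \<in> B. pivot \<pi> \<in> path_verts \<pi> k}"
      using sw(3,4) ijB other by (metis (no_types, lifting))
    then have pr: "pair \<rho> = (i, j)" unfolding ij[symmetric] pair_def piv by simp
    have t: "Transposition.transpose i j permutes B" using ijB by (intro permutes_swap_id)
    have w': "w' permutes B" unfolding w'_def using permutes_compose[OF t w] .
    have in_bad: "\<phi> z \<in> ?bad" unfolding \<phi>z using w' sw(1) sh ne by auto
    have invol: "\<phi> (\<phi> z) = z"
      unfolding \<phi>z by (simp add: \<phi>_def pr piv sw(2) w'_def w\<pi> comp_assoc)
    have "sign w' = - sign w"
    proof -
      have "permutation w" using w finB permutation_permutes by blast
      then show ?thesis unfolding w'_def using ijB(3)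
        by (simp add: sign_compose permutation_swap_id sign_swap_id)
    qed
    then have "F (\<phi> z) = - F z" unfolding \<phi>z using sw(7)[OF finB] by (simp add: w\<pi> F_def)
    then show ?thesis using in_bad invol by blast
  qed
  have "sum F ?bad = (\<Sum>z\<in>?bad. - F z)"
    by (rule sum.reindex_bij_witness[of _ \<phi> \<phi>]) (use step in auto)
  then have bad: "sum F ?bad = 0" by (simp add: sum_negf)
  \<comment> \<open>A nonidentity type has an inversion, hence two paths with interlaced ends, which
    meet. So vertex-disjoint families have identity type and sign \<open>1\<close>.\<close>
  have good: "?good = Pair id ` {\<pi> \<in> families_of_type B id. shared B (path_verts \<pi>) = {}}"
  proof (intro equalityI subsetI)
    fix z assume "z \<in> ?good"
    then obtain w \<pi> where z: "z = (w, \<pi>)" "w permutes B" "\<pi> \<in> families_of_type B w" "shared B (path_verts \<pi>) = {}"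
      by auto
    have "w = id"
    proof (rule ccontr)
      assume "w \<noteq> id"
      then obtain i k where ik: "i \<in> B" "k \<in> B" "i < k" "w k < w i"
        using inversion_of_nonid_permutation[OF z(2) finB] by blast
      have "w i \<in> B" "w k \<in> B" using ik z(2) by (simp_all add: permutes_in_image)
      then have "path_verts \<pi> i \<inter> path_verts \<pi> k \<noteq> {}"
        using ik B awalk_family[OF z(3)] by (intro crossing_paths_meet[of i k "w i" "w k"]) auto
      moreover have "path_verts \<pi> i \<inter> path_verts \<pi> k \<subseteq> shared B (path_verts \<pi>)"
        using sharedI[of i B k _ "path_verts \<pi>"] ik by auto
      ultimately show False using z(4) by simp
    qed
    then show "z \<in> Pair id ` {\<pi> \<in> families_of_type B id. shared B (path_verts \<pi>) = {}}" using z by auto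
  qed (auto simp: permutes_id)
  have "det_on B (path_matrix D wt s t) = (\<Sum>w | w permutes B. \<Sum>\<pi>\<in>families_of_type B w. F (w, \<pi>))"
    unfolding det_on_def path_matrix_def families_of_type_def
    by (simp add: prod_sum_PiE[OF finB finite_paths_between] F_def weight_on_def sum_distrib_left)
  also have "\<dots> = sum F ?Z"
    using finP finite_families_of_type[OF finB] by (subst sum.Sigma) auto
  also have "\<dots> = sum F ?bad + sum F ?good"
  proof -
    have "sum F ?Z = sum F (?bad \<union> ?good)" by (rule sum.cong) auto
    also have "\<dots> = sum F ?bad + sum F ?good"
      by (rule sum.union_disjoint) (auto intro: finite_subset[OF _ finZ])
    finally show ?thesis .
  qed
  also have "\<dots> = (\<Sum>\<pi> | \<pi> \<in> families_of_type B id \<and> shared B (path_verts \<pi>) = {}. weight_on B \<pi>)"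
    unfolding bad good by (subst sum.reindex) (auto simp: F_def inj_on_def sign_id)
  also have "\<dots> = (\<Sum>\<pi>\<in>families_of_type B id. weight_on B \<pi> * of_bool (shared B (path_verts \<pi>) = {}))"
    unfolding sum.inter_filter[OF finite_families_of_type[OF finB]] by (intro sum.cong) auto
  finally show ?thesis .
qed

end

section \<open>The three tableau formulas\<close>

lemma sum_PiE_mult:
  fixes f g :: "('i \<Rightarrow> 'p) \<Rightarrow> 'b::comm_semiring_0"
  assumes "C \<inter> C' = {}"
  shows "(\<Sum>\<pi>\<in>PiE C F. f \<pi>) * (\<Sum>\<pi>\<in>PiE C' F. g \<pi>) =
    (\<Sum>\<pi>\<in>PiE (C \<union> C') F. f (restrict \<pi> C) * g (restrict \<pi> C'))"
proof -
  have "(\<Sum>\<pi>\<in>PiE C F. f \<pi>) * (\<Sum>\<pi>\<in>PiE C' F. g \<pi>) = (\<Sum>(\<pi>, \<rho>)\<in>PiE C F \<times> PiE C' F. f \<pi> * g \<rho>)"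
    by (simp add: sum_product sum.cartesian_product)
  also have "\<dots> = (\<Sum>\<pi>\<in>PiE (C \<union> C') F. f (restrict \<pi> C) * g (restrict \<pi> C'))"
  proof (rule sum.reindex_bij_witness[of _ "\<lambda>\<pi>. (restrict \<pi> C, restrict \<pi> C')" "\<lambda>(\<pi>, \<rho>) i. if i \<in> C then \<pi> i else \<rho> i"])
    fix z assume "z \<in> PiE C F \<times> PiE C' F"
    then obtain \<pi> \<rho> where z: "z = (\<pi>, \<rho>)" "\<pi> \<in> PiE C F" "\<rho> \<in> PiE C' F" by auto
    have "restrict (\<lambda>i. if i \<in> C then \<pi> i else \<rho> i) C = \<pi>"
      using z(2) by (auto simp: fun_eq_iff PiE_iff extensional_def)
    moreover have "restrict (\<lambda>i. if i \<in> C then \<pi> i else \<rho> i) C' = \<rho>"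
      using z(3) assms by (auto simp: fun_eq_iff PiE_iff extensional_def)
    ultimately show "(case case z of (\<pi>, \<rho>) \<Rightarrow> \<lambda>i. if i \<in> C then \<pi> i else \<rho> i of \<pi> \<Rightarrow> (restrict \<pi> C, restrict \<pi> C')) = z"
      "f (restrict (case z of (\<pi>, \<rho>) \<Rightarrow> \<lambda>i. if i \<in> C then \<pi> i else \<rho> i) C) *
       g (restrict (case z of (\<pi>, \<rho>) \<Rightarrow> \<lambda>i. if i \<in> C then \<pi> i else \<rho> i) C') = (case z of (\<pi>, \<rho>) \<Rightarrow> f \<pi> * g \<rho>)"
      by (simp_all add: z(1))
    show "(case z of (\<pi>, \<rho>) \<Rightarrow> \<lambda>i. if i \<in> C then \<pi> i else \<rho> i) \<in> PiE (C \<union> C') F"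
      using z by (auto simp: PiE_iff extensional_def)
  next
    fix \<pi> assume \<pi>: "\<pi> \<in> PiE (C \<union> C') F"
    then show "(restrict \<pi> C, restrict \<pi> C') \<in> PiE C F \<times> PiE C' F" by (auto simp: PiE_iff)
    show "(case (restrict \<pi> C, restrict \<pi> C') of (\<pi>, \<rho>) \<Rightarrow> \<lambda>i. if i \<in> C then \<pi> i else \<rho> i) = \<pi>"
      using \<pi> by (auto simp: fun_eq_iff PiE_iff extensional_def)
  qed
  finally show ?thesis .
qed

lemma map_tableaux:
  assumes "inj_on f X" "U \<in> tableaux X lam"
  shows "map (map f) U \<in> tableaux (f ` X) lam"
proof -
  have "concat (map (map f) U) = map f (concat U)" by (simp add: map_concat)
  moreover have "map length (map (map f) U) = map length U" by simp
  ultimately show ?thesis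
    using assms unfolding tableaux_def by (simp add: distinct_map del: set_concat map_map)
qed

lemma bij_betw_map_tableaux:
  assumes "inj_on f X"
  shows "bij_betw (map (map f)) (tableaux X lam) (tableaux (f ` X) lam)"
proof (rule bij_betwI[where g = "map (map (inv_into X f))"])
  have sub: "set r \<subseteq> Y" if "U \<in> tableaux Y lam" "r \<in> set U" for r U and Y :: "'z set"
    using that by (auto simp: tableaux_def)
  show "map (map f) \<in> tableaux X lam \<rightarrow> tableaux (f ` X) lam"
    using map_tableaux[OF assms] by auto
  show "map (map (inv_into X f)) \<in> tableaux (f ` X) lam \<rightarrow> tableaux X lam"
    using map_tableaux[OF inj_on_inv_into[of "f ` X" f X]] inv_into_image_cancel[OF assms subset_refl] by auto
  show "map (map (inv_into X f)) (map (map f) U) = U" if "U \<in> tableaux X lam" for U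
  proof -
    have "map (\<lambda>x. inv_into X f (f x)) r = r" if "r \<in> set U" for r
      by (rule map_idI) (use sub[OF \<open>U \<in> _\<close> that] assms in \<open>auto simp: subset_iff\<close>)
    then show ?thesis by (simp add: comp_def map_idI)
  qed
  show "map (map f) (map (map (inv_into X f)) U) = U" if "U \<in> tableaux (f ` X) lam" for U
  proof -
    have "map (\<lambda>x. f (inv_into X f x)) r = r" if "r \<in> set U" for r
      by (rule map_idI) (use sub[OF \<open>U \<in> _\<close> that] in \<open>auto simp: subset_iff f_inv_into_f\<close>)
    then show ?thesis by (simp add: comp_def map_idI)
  qed
qed

lemma mult_sum_sum_distrib:
  fixes w :: "'b::comm_semiring_0"
  shows "w * (\<Sum>C\<in>A. a C * (\<Sum>r\<in>R C. b r) * d C) = (\<Sum>C\<in>A. \<Sum>r\<in>R C. a C * (w * (b r * d C)))"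
  by (simp add: sum_distrib_left sum_distrib_right mult_ac)

lemma row_semistrict_rows: "row_semistrict lt U \<longleftrightarrow> (\<forall>r\<in>set U. row_semistrict lt [r])"
  by (simp add: row_semistrict_def)

lemma record_free_rows: "record_free lt U \<longleftrightarrow> (\<forall>r\<in>set U. record_free lt [r])"
  by (auto simp: record_free_def)

lemma cyclically_row_semistrict_rows:
  "cyclically_row_semistrict lt U \<longleftrightarrow> (\<forall>r\<in>set U. cyclically_row_semistrict lt [r])"
  by (auto simp: cyclically_row_semistrict_def row_semistrict_def)

text \<open>This lemma and the next two serve twice: with a family as \<open>f\<close> they carry
  conditions from indices to paths, with \<open>f = id\<close> they show that a condition depends
  only on the relation among the entries of the row.\<close>

lemma row_semistrict_map:
  assumes "\<And>x y. x \<in> set r \<Longrightarrow> y \<in> set r \<Longrightarrow> lt (f x) (f y) = lt' x y"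
  shows "row_semistrict lt [map f r] \<longleftrightarrow> row_semistrict lt' [r]"
  using assms by (auto simp: row_semistrict_def)

lemma record_free_map:
  assumes "\<And>x y. x \<in> set r \<Longrightarrow> y \<in> set r \<Longrightarrow> lt (f x) (f y) = lt' x y"
  shows "record_free lt [map f r] \<longleftrightarrow> record_free lt' [r]"
proof -
  define A where "A = (\<lambda>j. \<forall>k<j. lt (map f r ! k) (map f r ! j))"
  define A' where "A' = (\<lambda>j. \<forall>k<j. lt' (r ! k) (r ! j))"
  have "A j = A' j" if "j < length r" for j
    using that assms by (auto simp: A_def A'_def)
  then have "(\<forall>j<length r. 0 < j \<longrightarrow> \<not> A j) \<longleftrightarrow> (\<forall>j<length r. 0 < j \<longrightarrow> \<not> A' j)" by auto
  then show ?thesis by (simp only: record_free_single length_map A_def A'_def)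
qed

lemma cyclically_row_semistrict_map:
  assumes "\<And>x y. x \<in> set r \<Longrightarrow> y \<in> set r \<Longrightarrow> lt (f x) (f y) = lt' x y" "r \<noteq> []"
  shows "cyclically_row_semistrict lt [map f r] \<longleftrightarrow> cyclically_row_semistrict lt' [r]"
  using row_semistrict_map[of r lt f lt', OF assms(1)] assms
  by (simp add: cyclically_row_semistrict_def hd_map last_map)

text \<open>The empty row is excluded because the closing condition of a cyclic row would compare
  the unspecified values \<open>hd []\<close> and \<open>last []\<close>.\<close>

definition row_local :: "((nat \<Rightarrow> nat \<Rightarrow> bool) \<Rightarrow> nat list \<Rightarrow> bool) \<Rightarrow> bool" where
  "row_local P \<longleftrightarrow> (\<forall>lt lt' r. r \<noteq> [] \<longrightarrow> (\<forall>x\<in>set r. \<forall>y\<in>set r. lt x y = lt' x y) \<longrightarrow> P lt r = P lt' r)"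

lemma row_localD:
  "row_local P \<Longrightarrow> r \<noteq> [] \<Longrightarrow> (\<And>x y. x \<in> set r \<Longrightarrow> y \<in> set r \<Longrightarrow> lt x y = lt' x y) \<Longrightarrow> P lt r = P lt' r"
  by (simp add: row_local_def)

lemma row_local_cyclic: "row_local (\<lambda>lt r. cyclically_row_semistrict lt [r])"
proof (unfold row_local_def, intro allI impI)
  fix lt lt' :: "nat \<Rightarrow> nat \<Rightarrow> bool" and r :: "nat list"
  assume "r \<noteq> []" "\<forall>x\<in>set r. \<forall>y\<in>set r. lt x y = lt' x y"
  then show "cyclically_row_semistrict lt [r] = cyclically_row_semistrict lt' [r]"
    using cyclically_row_semistrict_map[of r lt id lt'] by simp
qed

lemma row_local_record_free: "row_local (\<lambda>lt r. record_free lt [r] \<and> row_semistrict lt [r])"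
proof (unfold row_local_def, intro allI impI)
  fix lt lt' :: "nat \<Rightarrow> nat \<Rightarrow> bool" and r :: "nat list"
  assume "r \<noteq> []" "\<forall>x\<in>set r. \<forall>y\<in>set r. lt x y = lt' x y"
  then show "(record_free lt [r] \<and> row_semistrict lt [r]) = (record_free lt' [r] \<and> row_semistrict lt' [r])"
    using record_free_map[of r lt id lt'] row_semistrict_map[of r lt id lt'] by simp
qed

context planar_network begin

text \<open>The order of \<open>P(\<pi>)\<close> carried over to indices. It is confined to
  \<open>B\<close> because a family on \<open>B\<close> consists of paths only there.\<close>

definition apart :: "nat set \<Rightarrow> (nat \<Rightarrow> 'b list) \<Rightarrow> nat \<Rightarrow> nat \<Rightarrow> bool" where
  "apart B \<pi> i j \<longleftrightarrow> i \<in> B \<and> j \<in> B \<and> i < j \<and> path_verts \<pi> i \<inter> path_verts \<pi> j = {}"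

text \<open>The families live only on the indices of the row, which makes the sums belonging to
  different rows independent factors.\<close>

definition row_sum :: "((nat \<Rightarrow> nat \<Rightarrow> bool) \<Rightarrow> nat list \<Rightarrow> bool) \<Rightarrow> nat list \<Rightarrow> real" where
  "row_sum P r = (\<Sum>\<pi>\<in>families_of_type (set r) id. weight_on (set r) \<pi> * of_bool (P (apart (set r) \<pi>) r))"

lemma chain_on_apart:
  assumes "C \<subseteq> B"
  shows "chain_on (apart B \<pi>) C \<longleftrightarrow> shared C (path_verts \<pi>) = {}"
proof
  assume ch: "chain_on (apart B \<pi>) C"
  have "path_verts \<pi> i \<inter> path_verts \<pi> j = {}" if "i \<in> C" "j \<in> C" "i \<noteq> j" for i j
  proof (cases i j rule: linorder_cases)
    case less
    then show ?thesis using that ch by (simp add: chain_on_def apart_def)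
  next
    case greater
    then have "path_verts \<pi> j \<inter> path_verts \<pi> i = {}" using that ch by (simp add: chain_on_def apart_def)
    then show ?thesis by (simp add: Int_commute)
  qed (use that in simp)
  then show "shared C (path_verts \<pi>) = {}" unfolding shared_def by blast
next
  assume "shared C (path_verts \<pi>) = {}"
  then have "path_verts \<pi> i \<inter> path_verts \<pi> j = {}" if "i \<in> C" "j \<in> C" "i < j" for i j
    using that sharedI[of i C j _ "path_verts \<pi>"] by auto
  then show "chain_on (apart B \<pi>) C" using assms by (auto simp: chain_on_def apart_def subset_iff)
qed

lemma transp_apart:
  assumes "B \<subseteq> {1..n}" "\<pi> \<in> families_of_type B id"
  shows "transp (apart B \<pi>)"
proof (rule transpI)
  fix i j k assume a: "apart B \<pi> i j" "apart B \<pi> j k"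
  then have ix: "i \<in> B" "j \<in> B" "k \<in> B" "i < j" "j < k" by (auto simp: apart_def)
  have "path_verts \<pi> i \<inter> path_verts \<pi> k = {}"
  proof (rule ccontr)
    assume "path_verts \<pi> i \<inter> path_verts \<pi> k \<noteq> {}"
    then obtain v where v: "v \<in> path_verts \<pi> i" "v \<in> path_verts \<pi> k" by auto
    have w: "awalk (s l) (\<pi> l) (t l)" if "l \<in> B" for l using awalk_family[OF assms(2) that] by simp
    \<comment> \<open>Switching tracks at \<open>v\<close> gives a path which the middle path has to cross.\<close>
    let ?q = "before v (\<pi> i) @ after v (\<pi> k)"
    have "awalk (s i) ?q (t k)"
      using awalk_before_after(1)[OF w v(1)] awalk_before_after(2)[OF w v(2)] ix by (auto intro: awalk_appendI)
    moreover have "i \<in> {1..n}" "j \<in> {1..n}" "k \<in> {1..n}" using ix assms(1) by auto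
    ultimately have "set (awalk_verts (s i) ?q) \<inter> path_verts \<pi> j \<noteq> {}"
      using crossing_paths_meet[of i j k j ?q "\<pi> j"] ix w by blast
    moreover have "set (awalk_verts (s i) ?q) \<subseteq> path_verts \<pi> i \<union> path_verts \<pi> k"
      using set_awalk_verts_append[OF awalk_before_after(1)[OF w[OF ix(1)] v(1)] awalk_before_after(2)[OF w[OF ix(3)] v(2)]]
        set_awalk_verts_before_after[OF w[OF ix(1)] v(1)] set_awalk_verts_before_after[OF w[OF ix(3)] v(2)]
      by blast
    ultimately show False using a unfolding apart_def by blast
  qed
  then show "apart B \<pi> i k" using ix by (auto simp: apart_def)
qed

text \<open>Glues a family on one row to a family on \<open>C\<close>. The condition
  \<open>h\<close> stands for disjointness of the paths on the complement in the Newton recursion,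
  and for the conditions on the remaining rows of a tableau.\<close>

lemma row_sum_mult:
  assumes P: "row_local P" and r: "r \<noteq> []" and C: "set r \<inter> C = {}" "finite C"
    and local: "\<And>\<pi>. h (restrict \<pi> C) = h \<pi>"
  shows "row_sum P r * (\<Sum>\<pi>\<in>families_of_type C id. weight_on C \<pi> * of_bool (h \<pi>)) =
    (\<Sum>\<pi>\<in>families_of_type (set r \<union> C) id. weight_on (set r \<union> C) \<pi> *
       of_bool (P (apart (set r \<union> C) \<pi>) r \<and> h \<pi>))"
proof -
  have W: "weight_on B (restrict \<pi> B) = weight_on B \<pi>" for B \<pi>
    by (simp add: weight_on_def)
  have W_Un: "weight_on (set r \<union> C) \<pi> = weight_on (set r) \<pi> * weight_on C \<pi>" for \<pi>
    unfolding weight_on_def using C by (intro prod.union_disjoint) auto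
  have "P (apart (set r) (restrict \<pi> (set r))) r = P (apart (set r \<union> C) \<pi>) r" for \<pi>
    by (rule row_localD[OF P r]) (auto simp: apart_def)
  then show ?thesis
    unfolding row_sum_def families_of_type_def sum_PiE_mult[OF C(1)]
    by (intro sum.cong refl) (simp add: W W_Un local of_bool_conj)
qed

text \<open>The two sides obey the same recursion with the same minors. For \<open>row_sum\<close>
  it is obtained by applying \<open>newton\<close> to each family on \<open>B\<close> separately and
  then cutting the family into a row and its complement, where the chains sum to a minor
  again.\<close>

lemma sum_row_sum:
  assumes P: "row_local P"
    and newton: "\<And>lt B. (\<And>x y. lt x y \<Longrightarrow> x < y) \<Longrightarrow> transp lt \<Longrightarrow> finite B \<Longrightarrow>
       real (card B) * of_bool (chain_on lt B) =
       (\<Sum>C | C \<subseteq> B \<and> C \<noteq> {}. (-1) ^ (card C - 1) * (\<Sum>r\<in>permutations_of_set C. of_bool (P lt r)) * of_bool (chain_on lt (B - C)))"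
    and C: "C \<subseteq> {1..n}" "C \<noteq> {}"
  shows "(\<Sum>r\<in>permutations_of_set C. row_sum P r) = (\<Sum>r\<in>permutations_of_set C. cyc_prod (path_matrix D wt s t) r)"
proof -
  let ?a = "path_matrix D wt s t"
  have rec: "real (card B) * det_on B ?a =
     (\<Sum>C | C \<subseteq> B \<and> C \<noteq> {}. (-1) ^ (card C - 1) * (\<Sum>r\<in>permutations_of_set C. row_sum P r) * det_on (B - C) ?a)"
    if B: "B \<subseteq> {1..n}" for B
  proof -
    have finB: "finite B" using B finite_subset by blast
    have "real (card B) * det_on B ?a =
      (\<Sum>\<pi>\<in>families_of_type B id. weight_on B \<pi> * (real (card B) * of_bool (chain_on (apart B \<pi>) B)))"
      unfolding det_on_path_matrix[OF B] by (simp add: sum_distrib_left chain_on_apart mult_ac)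
    also have "\<dots> = (\<Sum>\<pi>\<in>families_of_type B id. \<Sum>C | C \<subseteq> B \<and> C \<noteq> {}. \<Sum>r\<in>permutations_of_set C. (-1) ^ (card C - 1) *
        (weight_on B \<pi> * of_bool (P (apart B \<pi>) r \<and> chain_on (apart B \<pi>) (B - C))))"
    proof (rule sum.cong[OF refl])
      fix \<pi> assume "\<pi> \<in> families_of_type B id"
      then have *: "real (card B) * of_bool (chain_on (apart B \<pi>) B) =
         (\<Sum>C | C \<subseteq> B \<and> C \<noteq> {}. (-1) ^ (card C - 1) * (\<Sum>r\<in>permutations_of_set C. of_bool (P (apart B \<pi>) r)) *
            of_bool (chain_on (apart B \<pi>) (B - C)))"
        using transp_apart[OF B] finB by (intro newton) (auto simp: apart_def)
      show "weight_on B \<pi> * (real (card B) * of_bool (chain_on (apart B \<pi>) B)) =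
         (\<Sum>C | C \<subseteq> B \<and> C \<noteq> {}. \<Sum>r\<in>permutations_of_set C. (-1) ^ (card C - 1) *
           (weight_on B \<pi> * of_bool (P (apart B \<pi>) r \<and> chain_on (apart B \<pi>) (B - C))))"
        unfolding * mult_sum_sum_distrib of_bool_conj ..
    qed
    also have "\<dots> = (\<Sum>C | C \<subseteq> B \<and> C \<noteq> {}. \<Sum>r\<in>permutations_of_set C. (-1) ^ (card C - 1) *
        (\<Sum>\<pi>\<in>families_of_type B id. weight_on B \<pi> * of_bool (P (apart B \<pi>) r \<and> chain_on (apart B \<pi>) (B - C))))"
      by (subst sum.swap) (intro sum.cong refl, subst sum.swap, simp add: sum_distrib_left)
    also have "\<dots> = (\<Sum>C | C \<subseteq> B \<and> C \<noteq> {}. \<Sum>r\<in>permutations_of_set C. (-1) ^ (card C - 1) * (row_sum P r * det_on (B - C) ?a))"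
    proof (intro sum.cong refl)
      fix C r assume "C \<in> {C. C \<subseteq> B \<and> C \<noteq> {}}" "r \<in> permutations_of_set C"
      then have C: "C = set r" "set r \<union> (B - set r) = B" "r \<noteq> []" "set r \<inter> (B - set r) = {}" "finite (B - set r)"
        using finB by (auto simp: permutations_of_set_def)
      have "row_sum P r * det_on (B - set r) ?a =
        row_sum P r * (\<Sum>\<pi>\<in>families_of_type (B - set r) id. weight_on (B - set r) \<pi> * of_bool (shared (B - set r) (path_verts \<pi>) = {}))"
        using det_on_path_matrix[of "B - set r"] B by auto
      also have "\<dots> = (\<Sum>\<pi>\<in>families_of_type (set r \<union> (B - set r)) id. weight_on (set r \<union> (B - set r)) \<pi> *
          of_bool (P (apart (set r \<union> (B - set r)) \<pi>) r \<and> shared (B - set r) (path_verts \<pi>) = {}))"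
        by (rule row_sum_mult[OF P C(3,4,5)]) (auto simp: shared_def)
      finally show "(-1) ^ (card C - 1) * (\<Sum>\<pi>\<in>families_of_type B id. weight_on B \<pi> * of_bool (P (apart B \<pi>) r \<and> chain_on (apart B \<pi>) (B - C))) =
         (-1) ^ (card C - 1) * (row_sum P r * det_on (B - C) ?a)"
        unfolding C(2) by (simp add: C(1) chain_on_apart)
    qed
    finally show ?thesis by (simp add: sum_distrib_left sum_distrib_right mult_ac del: sum_of_bool_eq)
  qed
  have finC: "finite C" using C(1) finite_subset by blast
  show ?thesis
  proof (rule newton_recursion_unique[where E = "\<lambda>B. det_on B ?a" and X = "{1..n}", OF finC C(2)])
    fix B :: "nat set" assume "finite B" "B \<subseteq> {1..n}"
    then show "(\<Sum>C | C \<subseteq> B \<and> C \<noteq> {}. (-1) ^ (card C - 1) * (\<Sum>r\<in>permutations_of_set C. row_sum P r) * det_on (B - C) ?a) =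
      (\<Sum>C | C \<subseteq> B \<and> C \<noteq> {}. (-1) ^ (card C - 1) * (\<Sum>r\<in>permutations_of_set C. cyc_prod ?a r) * det_on (B - C) ?a)"
      using rec card_mult_det_on[of B ?a] by simp
  qed (use C in simp_all)
qed

text \<open>The rows occupy disjoint index sets, so their families assemble into one family;
  locality allows every row to be judged by the relation on the whole index set.\<close>

lemma prod_list_row_sum:
  assumes "row_local P" "distinct (concat V)" "[] \<notin> set V"
  shows "prod_list (map (row_sum P) V) =
    (\<Sum>\<pi>\<in>families_of_type (set (concat V)) id. weight_on (set (concat V)) \<pi> *
       of_bool (\<forall>r\<in>set V. P (apart (set (concat V)) \<pi>) r))"
  using assms(2,3)
proof (induction V)
  case Nil
  then show ?case by (simp add: families_of_type_def weight_on_def)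
next
  case (Cons r V)
  let ?C = "set (concat V)" and ?B = "set (concat (r # V))"
  have r: "r \<noteq> []" "set r \<inter> ?C = {}" "finite ?C" using Cons.prems by auto
  have cong: "(\<forall>q\<in>set V. P (apart ?C (restrict \<pi> ?C)) q) = (\<forall>q\<in>set V. P (apart ?C \<pi>) q)"
    "(\<forall>q\<in>set V. P (apart ?C \<pi>) q) = (\<forall>q\<in>set V. P (apart ?B \<pi>) q)" for \<pi>
    using Cons.prems by (auto intro!: ball_cong row_localD[OF assms(1)] simp: apart_def simp del: set_concat) (auto simp: apart_def)
  have IH: "prod_list (map (row_sum P) V) =
    (\<Sum>\<pi>\<in>families_of_type ?C id. weight_on ?C \<pi> * of_bool (\<forall>q\<in>set V. P (apart ?C \<pi>) q))"
    using Cons.prems by (intro Cons.IH) auto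
  have "prod_list (map (row_sum P) (r # V)) = row_sum P r *
    (\<Sum>\<pi>\<in>families_of_type ?C id. weight_on ?C \<pi> * of_bool (\<forall>q\<in>set V. P (apart ?C \<pi>) q))"
    by (simp only: list.map prod_list.Cons IH)
  also have "\<dots> = (\<Sum>\<pi>\<in>families_of_type (set r \<union> ?C) id. weight_on (set r \<union> ?C) \<pi> *
       of_bool (P (apart (set r \<union> ?C) \<pi>) r \<and> (\<forall>q\<in>set V. P (apart ?C \<pi>) q)))"
    by (rule row_sum_mult[where h = "\<lambda>\<pi>. \<forall>q\<in>set V. P (apart ?C \<pi>) q", OF assms(1) r cong(1)])
  finally show ?case unfolding cong(2) by (simp add: id_def)
qed

section \<open>From indices to tableaux of paths\<close>

text \<open>As no source is a sink, the path has an arc, and its arcs determine both ends. With the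
  distinctness of the terminals this makes the two definite descriptions meaningful.\<close>

lemma terminals_of_path:
  assumes "i \<in> {1..n}" "j \<in> {1..n}" "awalk (s i) p (t j)"
  shows "source_index D n s p = i" "sink_index D n t p = j"
proof -
  have ne: "p \<noteq> []" using assms s_neq_t by (auto simp: awalk_Nil_iff)
  have ends: "u = s i \<and> v = t j" if "awalk u p v" for u v
    using awalk_ends[OF assms(3) that] ne by auto
  show "source_index D n s p = i"
    unfolding source_index_def
  proof (rule the_equality)
    show "i \<in> {1..n} \<and> (\<exists>v. p \<in> paths_between D (s i) v)"
      using assms by (auto simp: paths_between_iff)
    fix k assume k: "k \<in> {1..n} \<and> (\<exists>v. p \<in> paths_between D (s k) v)"
    then have "s k = s i" using ends by (auto simp: paths_between_iff)
    then show "k = i" using inj_on_s k assms(1) by (auto dest: inj_onD)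
  qed
  show "sink_index D n t p = j"
    unfolding sink_index_def
  proof (rule the_equality)
    show "j \<in> {1..n} \<and> (\<exists>u. p \<in> paths_between D u (t j))"
      using assms by (auto simp: paths_between_iff)
    fix k assume k: "k \<in> {1..n} \<and> (\<exists>u. p \<in> paths_between D u (t k))"
    then have "t k = t j" using ends by (auto simp: paths_between_iff)
    then show "k = j" using inj_on_t k assms(2) by (auto dest: inj_onD)
  qed
qed

lemma source_sink_family:
  assumes "w permutes {1..n}" "\<pi> \<in> families_of_type {1..n} w" "i \<in> {1..n}"
  shows "source_index D n s (\<pi> i) = i" "sink_index D n t (\<pi> i) = w i"
proof -
  have "w i \<in> {1..n}" using assms(1,3) by (metis permutes_in_image)
  then show "source_index D n s (\<pi> i) = i" "sink_index D n t (\<pi> i) = w i"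
    using terminals_of_path[OF assms(3) _ awalk_family[OF assms(2,3)]] by auto
qed

text \<open>A path remembers its source. Hence filling tableaux with paths is the same as filling
  them with indices.\<close>

lemma inj_on_family:
  assumes "w permutes {1..n}" "\<pi> \<in> families_of_type {1..n} w"
  shows "inj_on \<pi> {1..n}"
  using source_sink_family(1)[OF assms] by (metis inj_onI)

lemma families_of_type_iff:
  "\<pi> \<in> families_of_type B w \<longleftrightarrow> \<pi> \<in> extensional B \<and> (\<forall>i\<in>B. \<pi> i \<in> paths_between D (s i) (t (w i)))"
  by (auto simp: families_of_type_def PiE_iff)

lemma path_families_eq: "path_families D n s t = (\<Union>w\<in>{w. w permutes {1..n}}. families_of_type {1..n} w)"
  unfolding path_families_def family_has_type_def set_eq_iff UN_iff families_of_type_iff by blast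

lemma path_families_id_eq: "path_families_id D n s t = families_of_type {1..n} id"
  unfolding path_families_id_def path_families_def family_has_type_def set_eq_iff mem_Collect_eq families_of_type_iff
  using permutes_id[of "{1..n}"] by blast

lemma family_less_iff:
  assumes \<pi>: "\<pi> \<in> families_of_type {1..n} id" and ij: "i \<in> {1..n}" "j \<in> {1..n}"
  shows "family_less D n s \<pi> (\<pi> i) (\<pi> j) \<longleftrightarrow> apart {1..n} \<pi> i j"
proof -
  have "inj_on \<pi> {1..n}" using inj_on_family[OF permutes_id \<pi>] .
  then have eq: "\<pi> k = \<pi> l \<longleftrightarrow> k = l" if "k \<in> {1..n}" "l \<in> {1..n}" for k l
    using that by (rule inj_on_eq_iff)
  show ?thesis
  proof
    assume "family_less D n s \<pi> (\<pi> i) (\<pi> j)"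
    then obtain k l where "k \<in> {1..n}" "l \<in> {1..n}" "\<pi> i = \<pi> k" "\<pi> j = \<pi> l" "k < l"
      "path_verts \<pi> k \<inter> path_verts \<pi> l = {}"
      unfolding family_less_def by blast
    moreover from this have "k = i" "l = j" using eq ij by blast+
    ultimately show "apart {1..n} \<pi> i j" by (simp add: apart_def)
  next
    assume "apart {1..n} \<pi> i j"
    then show "family_less D n s \<pi> (\<pi> i) (\<pi> j)" unfolding family_less_def apart_def by blast
  qed
qed

text \<open>The common frame of the two formulas over identity families: \<open>P\<close> is the
  condition on one row of indices, \<open>Q\<close> the condition on a tableau of paths, and
  \<open>transfer\<close> relates them.\<close>

lemma immanant_psi_identity_families:
  assumes lam: "lam \<turnstile> n" and P: "row_local P"
    and newton: "\<And>lt B. (\<And>x y. lt x y \<Longrightarrow> x < y) \<Longrightarrow> transp lt \<Longrightarrow> finite B \<Longrightarrow>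
       real (card B) * of_bool (chain_on lt B) =
       (\<Sum>C | C \<subseteq> B \<and> C \<noteq> {}. (-1) ^ (card C - 1) * (\<Sum>r\<in>permutations_of_set C. of_bool (P lt r)) * of_bool (chain_on lt (B - C)))"
    and transfer: "\<And>\<pi> V. \<pi> \<in> families_of_type {1..n} id \<Longrightarrow> V \<in> tableaux {1..n} lam \<Longrightarrow>
       Q \<pi> (map (map \<pi>) V) \<longleftrightarrow> (\<forall>r\<in>set V. P (apart {1..n} \<pi>) r)"
  shows "immanant n (psi lam) (path_matrix D wt s t) =
    (\<Sum>\<pi>\<in>path_families_id D n s t. family_weight n wt \<pi> * real (card {U \<in> tableaux (family_paths n \<pi>) lam. Q \<pi> U}))"
proof -
  let ?T = "tableaux {1..n} lam" and ?\<Pi> = "families_of_type {1..n} id"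
  have lam0: "0 \<notin> set lam" using lam by (simp add: is_partition_def)
  have finT: "finite ?T" by (rule finite_tableaux) simp
  have card: "real (card {U \<in> tableaux (family_paths n \<pi>) lam. Q \<pi> U}) =
     (\<Sum>V\<in>?T. of_bool (\<forall>r\<in>set V. P (apart {1..n} \<pi>) r))" if \<pi>: "\<pi> \<in> ?\<Pi>" for \<pi>
  proof -
    have "bij_betw (map (map \<pi>)) {V \<in> ?T. \<forall>r\<in>set V. P (apart {1..n} \<pi>) r} {U \<in> tableaux (family_paths n \<pi>) lam. Q \<pi> U}"
      unfolding family_paths_def
      using transfer[OF \<pi>] by (intro bij_betw_Collect[OF bij_betw_map_tableaux] inj_on_family[OF permutes_id \<pi>]) auto
    then have "card {U \<in> tableaux (family_paths n \<pi>) lam. Q \<pi> U} = card {V \<in> ?T. \<forall>r\<in>set V. P (apart {1..n} \<pi>) r}"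
      by (simp add: bij_betw_same_card)
    then show ?thesis using finT by (simp add: sum_of_bool_eq Int_def)
  qed
  have "immanant n (psi lam) (path_matrix D wt s t) = (\<Sum>V\<in>?T. prod_list (map (cyc_prod (path_matrix D wt s t)) V))"
    by (rule immanant_psi_eq[OF lam])
  also have "\<dots> = (\<Sum>V\<in>?T. prod_list (map (row_sum P) V))"
    using sum_row_sum[OF P newton] lam0 by (intro sum_tableaux_prod_cong) auto
  also have "\<dots> = (\<Sum>V\<in>?T. \<Sum>\<pi>\<in>?\<Pi>. weight_on {1..n} \<pi> * of_bool (\<forall>r\<in>set V. P (apart {1..n} \<pi>) r))"
  proof (rule sum.cong[OF refl])
    fix V assume "V \<in> ?T"
    then have V: "distinct (concat V)" "set (concat V) = {1..n}" "map length V = lam" by (auto simp: tableaux_def)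
    have "[] \<notin> set V" using V(3) lam0 by force
    then show "prod_list (map (row_sum P) V) = (\<Sum>\<pi>\<in>?\<Pi>. weight_on {1..n} \<pi> * of_bool (\<forall>r\<in>set V. P (apart {1..n} \<pi>) r))"
      using prod_list_row_sum[OF P V(1)] V(2) by simp
  qed
  also have "\<dots> = (\<Sum>\<pi>\<in>?\<Pi>. weight_on {1..n} \<pi> * (\<Sum>V\<in>?T. of_bool (\<forall>r\<in>set V. P (apart {1..n} \<pi>) r)))"
    by (subst sum.swap) (simp add: sum_distrib_left)
  also have "\<dots> = (\<Sum>\<pi>\<in>path_families_id D n s t. family_weight n wt \<pi> * real (card {U \<in> tableaux (family_paths n \<pi>) lam. Q \<pi> U}))"
    unfolding path_families_id_eq using card by (intro sum.cong) (auto simp: family_weight_def weight_on_def)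
  finally show ?thesis .
qed

lemma rows_of_tableau:
  assumes "lam \<turnstile> n" "V \<in> tableaux {1..n} lam" "r \<in> set V"
  shows "set r \<subseteq> {1..n}" "r \<noteq> []"
  using assms by (auto simp: tableaux_def is_partition_def)

lemma immanant_psi_cyclic:
  assumes "lam \<turnstile> n"
  shows "immanant n (psi lam) (path_matrix D wt s t) =
    (\<Sum>\<pi>\<in>path_families_id D n s t. family_weight n wt \<pi> *
       real (card {U \<in> tableaux (family_paths n \<pi>) lam. cyclically_row_semistrict (family_less D n s \<pi>) U}))"
proof (rule immanant_psi_identity_families[OF assms row_local_cyclic card_mult_chain_cyclic])
  fix \<pi> V assume \<pi>: "\<pi> \<in> families_of_type {1..n} id" and V: "V \<in> tableaux {1..n} lam"
  have "cyclically_row_semistrict (family_less D n s \<pi>) [map \<pi> r] \<longleftrightarrow> cyclically_row_semistrict (apart {1..n} \<pi>) [r]"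
    if "r \<in> set V" for r
    using rows_of_tableau[OF assms V that] family_less_iff[OF \<pi>]
    by (intro cyclically_row_semistrict_map) (auto simp: subset_iff)
  then show "cyclically_row_semistrict (family_less D n s \<pi>) (map (map \<pi>) V) \<longleftrightarrow>
      (\<forall>r\<in>set V. cyclically_row_semistrict (apart {1..n} \<pi>) [r])"
    by (simp add: cyclically_row_semistrict_rows[of _ "map (map \<pi>) V"])
qed

lemma immanant_psi_record_free:
  assumes "lam \<turnstile> n"
  shows "immanant n (psi lam) (path_matrix D wt s t) =
    (\<Sum>\<pi>\<in>path_families_id D n s t. family_weight n wt \<pi> *
       real (card {U \<in> tableaux (family_paths n \<pi>) lam.
         record_free (family_less D n s \<pi>) U \<and> row_semistrict (family_less D n s \<pi>) U}))"
proof (rule immanant_psi_identity_families[OF assms row_local_record_free card_mult_chain_record_free])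
  fix \<pi> V assume \<pi>: "\<pi> \<in> families_of_type {1..n} id" and V: "V \<in> tableaux {1..n} lam"
  have agree: "family_less D n s \<pi> (\<pi> x) (\<pi> y) = apart {1..n} \<pi> x y" if "r \<in> set V" "x \<in> set r" "y \<in> set r" for r x y
    using rows_of_tableau[OF assms V that(1)] family_less_iff[OF \<pi>] that(2,3) by (auto simp: subset_iff)
  have "record_free (family_less D n s \<pi>) [map \<pi> r] \<longleftrightarrow> record_free (apart {1..n} \<pi>) [r]"
    "row_semistrict (family_less D n s \<pi>) [map \<pi> r] \<longleftrightarrow> row_semistrict (apart {1..n} \<pi>) [r]" if "r \<in> set V" for r
    using agree[OF that] by (intro record_free_map row_semistrict_map; simp)+
  then show "record_free (family_less D n s \<pi>) (map (map \<pi>) V) \<and> row_semistrict (family_less D n s \<pi>) (map (map \<pi>) V) \<longleftrightarrow>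
      (\<forall>r\<in>set V. record_free (apart {1..n} \<pi>) [r] \<and> row_semistrict (apart {1..n} \<pi>) [r])"
    by (auto simp: record_free_rows[of _ "map (map \<pi>) V"] row_semistrict_rows[of _ "map (map \<pi>) V"])
qed

text \<open>The path starting at \<open>i\<close> ends at \<open>w i\<close>, so in a cylindrical
  tableau the rows of indices are cycles of \<open>w\<close>. The count thus depends only on the
  type and equals the coefficient \<open>psi lam w\<close>.\<close>

lemma immanant_psi_cylindrical:
  assumes "lam \<turnstile> n"
  shows "immanant n (psi lam) (path_matrix D wt s t) =
    (\<Sum>\<pi>\<in>path_families D n s t. family_weight n wt \<pi> *
       real (card {U \<in> tableaux (family_paths n \<pi>) lam. cylindrical D n s t U}))"
proof -
  let ?S = "{w. w permutes {1..n}}" and ?N = "\<lambda>\<pi>. real (card {U \<in> tableaux (family_paths n \<pi>) lam. cylindrical D n s t U})"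
  have card: "?N \<pi> = psi lam w" if w: "w permutes {1..n}" and \<pi>: "\<pi> \<in> families_of_type {1..n} w" for w \<pi>
  proof -
    have "cylindrical D n s t (map (map \<pi>) V) \<longleftrightarrow> (\<forall>r\<in>set V. map w r = rotate1 r)" if V: "V \<in> tableaux {1..n} lam" for V
    proof -
      have "map (sink_index D n t) (map \<pi> r) = map (source_index D n s) (rotate1 (map \<pi> r)) \<longleftrightarrow> map w r = rotate1 r"
        if "r \<in> set V" for r
      proof -
        have ss: "source_index D n s (\<pi> x) = x" "sink_index D n t (\<pi> x) = w x" if "x \<in> set r" for x
          using source_sink_family[OF w \<pi>, of x] rows_of_tableau(1)[OF assms V \<open>r \<in> set V\<close>] that by auto
        have "map (sink_index D n t) (map \<pi> r) = map w r" using ss by simp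
        moreover have "map (source_index D n s) (rotate1 (map \<pi> r)) = rotate1 r"
          using ss by (simp add: rotate1_map[symmetric] map_idI)
        ultimately show ?thesis by (simp only:)
      qed
      then show ?thesis by (simp add: cylindrical_def del: map_map)
    qed
    then have "bij_betw (map (map \<pi>)) {V \<in> tableaux {1..n} lam. \<forall>r\<in>set V. map w r = rotate1 r}
        {U \<in> tableaux (family_paths n \<pi>) lam. cylindrical D n s t U}"
      unfolding family_paths_def
      by (intro bij_betw_Collect[OF bij_betw_map_tableaux] inj_on_family[OF w \<pi>]) auto
    then show ?thesis using card_cyclic_tableaux_psi[OF w assms] by (simp add: bij_betw_same_card)
  qed
  \<comment> \<open>The sink indices reveal the type, so the sum over types and their families is a
    sum over all path families without repetition.\<close>
  have disj: "families_of_type {1..n} w \<inter> families_of_type {1..n} w' = {}"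
    if "w \<in> ?S" "w' \<in> ?S" "w \<noteq> w'" for w w'
  proof (rule ccontr)
    assume "families_of_type {1..n} w \<inter> families_of_type {1..n} w' \<noteq> {}"
    then obtain \<pi> where \<pi>: "\<pi> \<in> families_of_type {1..n} w" "\<pi> \<in> families_of_type {1..n} w'" by auto
    have "w i = w' i" for i
    proof (cases "i \<in> {1..n}")
      case True
      then show ?thesis using source_sink_family(2)[OF _ \<pi>(1) True] source_sink_family(2)[OF _ \<pi>(2) True] that by simp
    next
      case False
      then show ?thesis using that by (simp add: permutes_not_in)
    qed
    then show False using that by auto
  qed
  have "immanant n (psi lam) (path_matrix D wt s t) =
     (\<Sum>w\<in>?S. \<Sum>\<pi>\<in>families_of_type {1..n} w. weight_on {1..n} \<pi> * psi lam w)"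
    unfolding immanant_def path_matrix_def families_of_type_def weight_on_def
    by (simp add: prod_sum_PiE finite_paths_between sum_distrib_left sum_distrib_right mult_ac)
  also have "\<dots> = (\<Sum>w\<in>?S. \<Sum>\<pi>\<in>families_of_type {1..n} w. family_weight n wt \<pi> * ?N \<pi>)"
    using card by (intro sum.cong refl) (auto simp: weight_on_def family_weight_def)
  also have "\<dots> = (\<Sum>\<pi>\<in>path_families D n s t. family_weight n wt \<pi> * ?N \<pi>)"
    unfolding path_families_eq using disj
    by (intro sum.UNION_disjoint[symmetric]) (auto intro: finite_families_of_type finite_permutations)
  finally show ?thesis .
qed

end

theorem theorem4p16:
  fixes D :: "('a, 'b) pre_digraph" and n :: nat and wt :: "'b \<Rightarrow> real"
    and s t :: "nat \<Rightarrow> 'a" and lam :: "nat list"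
  assumes "planar_network D n wt s t" and "lam \<turnstile> n"
  shows
    "immanant n (psi lam) (path_matrix D wt s t) =
       (\<Sum>\<pi>\<in>path_families_id D n s t. family_weight n wt \<pi> *
          real (card {U \<in> tableaux (family_paths n \<pi>) lam.
            cyclically_row_semistrict (family_less D n s \<pi>) U})) \<and>
     immanant n (psi lam) (path_matrix D wt s t) =
       (\<Sum>\<pi>\<in>path_families_id D n s t. family_weight n wt \<pi> *
          real (card {U \<in> tableaux (family_paths n \<pi>) lam.
            record_free (family_less D n s \<pi>) U \<and> row_semistrict (family_less D n s \<pi>) U})) \<and>
     immanant n (psi lam) (path_matrix D wt s t) =
       (\<Sum>\<pi>\<in>path_families D n s t. family_weight n wt \<pi> *
          real (card {U \<in> tableaux (family_paths n \<pi>) lam. cylindrical D n s t U}))"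
proof -
  interpret planar_network D n wt s t by (rule assms(1))
  show ?thesis
    by (intro conjI immanant_psi_cyclic immanant_psi_record_free immanant_psi_cylindrical assms(2))
qed

end
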